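(* Let $\varphi:\mathbb D\to\mathbb D$ be analytic. Let $\sigma:[0,1)\to(0,\infty)$ be continuous and integrable such that $\omega_\sigma(r)=\int_r^1(t-r)\sigma(t)\,dt$ is (I)-admissible, and set $G(z)=\omega_\sigma(|z|)/(1-|z|)$ for $z\in\mathbb D$. (i) If $\displaystyle\lim_{|z|\to1^-}\frac{G(z)}{G(\varphi(z))}=0$, then $C_\varphi$ is compact on $\mathcal A^2_\sigma(\mathbb D)$. (ii) If $\omega_\sigma$ satisfies condition $(\kappa)$ and $\displaystyle\lim_{|z|\to1^-}\frac{1-|\varphi(z)|}{1-|z|}=\infty$, then $C_\varphi$ is compact on $\mathcal A^2_\sigma(\mathbb D)$.
   Context: $\mathbb D$ is the open unit disc, $dA=dx\,dy/\pi$, $C_\varphi f=f\circ\varphi$. $\mathcal A^2_\sigma(\mathbb D)$ is the space of analytic $f$ on $\mathbb D$ with $\int_{\mathbb D}|f(z)|^2\sigma(|z|)\,dA(z)<\infty$. A positive integrable $\omega\in C^2[0,1)$ is (I)-admissible if: (W1) $\omega$ non-increasing; (W2) there is $\delta>0$ with $r\mapsto\omega(r)(1-r)^{-(1+\delta)}$ non-decreasing on $[0,1)$; (W3) $\lim_{r\to1^-}\omega(r)=0$; (W4(I)) $\omega$ convex and $\lim_{r\to1^-}\omega'(r)=0$. Writing $\tilde\omega_\sigma(x)=\omega_\sigma(1-x)$, the weight $\omega_\sigma$ satisfies condition $(\kappa)$ if $\displaystyle\lim_{\eta\to0^+}\limsup_{x\to0^+}\frac{\tilde\omega_\sigma(\eta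 x)}{\eta\,\tilde\omega_\sigma(x)}=0$. *)

theory Defs
  imports "HOL-Analysis.Analysis"
begin

text \<open>Weighted Bergman space A^2_sigma on the unit disc, with dA = dx dy / pi.\<close>

definition A2_integral :: "(real \<Rightarrow> real) \<Rightarrow> (complex \<Rightarrow> complex) \<Rightarrow> ennreal" where
  "A2_integral \<sigma> f =
     (\<integral>\<^sup>+ z. ennreal ((cmod (f z))\<^sup>2 * \<sigma> (cmod z) / pi) * indicator (ball 0 1) z \<partial>lborel)"

definition A2_space :: "(real \<Rightarrow> real) \<Rightarrow> (complex \<Rightarrow> complex) set" where
  "A2_space \<sigma> = {f. f holomorphic_on ball 0 1 \<and> A2_integral \<sigma> f < \<infinity>}"

definition A2_norm :: "(real \<Rightarrow> real) \<Rightarrow> (complex \<Rightarrow> complex) \<Rightarrow> real" where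
  "A2_norm \<sigma> f = sqrt (enn2real (A2_integral \<sigma> f))"

definition compact_composition :: "(real \<Rightarrow> real) \<Rightarrow> (complex \<Rightarrow> complex) \<Rightarrow> bool" where
  "compact_composition \<sigma> \<phi> \<longleftrightarrow>
     (\<forall>f \<in> A2_space \<sigma>. f \<circ> \<phi> \<in> A2_space \<sigma>) \<and>
     (\<forall>F :: nat \<Rightarrow> complex \<Rightarrow> complex. (\<forall>n. F n \<in> A2_space \<sigma>) \<longrightarrow>
        (\<exists>B. \<forall>n. A2_norm \<sigma> (F n) \<le> B) \<longrightarrow>
        (\<exists>r g. strict_mono r \<and> g \<in> A2_space \<sigma> \<and>
            (\<lambda>n. A2_norm \<sigma> (\<lambda>z. F (r n) (\<phi> z) - g z)) \<longlonglongrightarrow> 0))"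

definition omega_sigma :: "(real \<Rightarrow> real) \<Rightarrow> real \<Rightarrow> real" where
  "omega_sigma \<sigma> r = integral {r..1} (\<lambda>t. (t - r) * \<sigma> t)"

definition I_admissible :: "(real \<Rightarrow> real) \<Rightarrow> bool" where
  "I_admissible \<omega> \<longleftrightarrow>
     (\<forall>r\<in>{0..<1}. \<omega> r > 0) \<and> \<omega> integrable_on {0..<1} \<and>
     (\<exists>\<omega>' \<omega>''.
        (\<forall>r\<in>{0..<1}. (\<omega> has_real_derivative \<omega>' r) (at r within {0..<1})) \<and>
        (\<forall>r\<in>{0..<1}. (\<omega>' has_real_derivative \<omega>'' r) (at r within {0..<1})) \<and>
        continuous_on {0..<1} \<omega>'' \<and>
        \<comment> \<open>(W4(I)) second part\<close>
        (\<omega>' \<longlongrightarrow> 0) (at_left 1)) \<and>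
     \<comment> \<open>(W1)\<close>
     (\<forall>r\<in>{0..<1}. \<forall>s\<in>{0..<1}. r \<le> s \<longrightarrow> \<omega> s \<le> \<omega> r) \<and>
     \<comment> \<open>(W2)\<close>
     (\<exists>\<delta>>0. mono_on {0..<1} (\<lambda>r. \<omega> r / (1 - r) powr (1 + \<delta>))) \<and>
     \<comment> \<open>(W3)\<close>
     (\<omega> \<longlongrightarrow> 0) (at_left 1) \<and>
     \<comment> \<open>(W4(I)) first part\<close>
     convex_on {0..<1} \<omega>"

text \<open>Condition (kappa), with tilde-omega(x) = omega(1 - x).\<close>

definition condition_kappa :: "(real \<Rightarrow> real) \<Rightarrow> bool" where
  "condition_kappa \<omega> \<longleftrightarrow>
     ((\<lambda>\<eta>. Limsup (at_right 0) (\<lambda>x. ereal (\<omega> (1 - \<eta> * x) / (\<eta> * \<omega> (1 - x)))))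
        \<longlongrightarrow> 0) (at_right 0)"

end

theory Submission
  imports Defs "HOL-Complex_Analysis.Complex_Analysis"
begin

text \<open>
  Put \<open>T(r) = \<integral>\<^sub>r\<^sup>1 t \<sigma>(t) dt\<close>. Always \<open>G \<le> T\<close>, and (W2) gives \<open>T \<le> C G\<close> near the boundary, so the hypothesis
  of (i) says that \<open>T(|z|) \<le> \<epsilon> T(|\<phi>(z)|)\<close> for \<open>|z|\<close> close to 1. Hence \<open>\<phi>\<close> maps the disc of radius \<open>r\<close> into the
  disc of radius \<open>\<rho>(r)\<close> defined by \<open>T(\<rho>(r)) = T(r) / \<epsilon>\<close>, and Littlewood's subordination principle bounds the
  mean of \<open>|f \<circ> \<phi>|\<^sup>2\<close> over the circle of radius \<open>r\<close> by a constant times the mean of \<open>|f|\<^sup>2\<close> over the circle of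
  radius \<open>\<rho>(r)\<close>. Integrating against \<open>r \<sigma>(r) dr = -dT(r)\<close> and substituting \<open>\<rho> = \<rho>(r)\<close>, which scales \<open>dT\<close> by
  \<open>\<epsilon>\<close>, the part of the norm of \<open>f \<circ> \<phi>\<close> near the boundary is at most \<open>C \<epsilon>\<close> times the norm of \<open>f\<close>. On the rest of
  the disc Montel's theorem gives uniform convergence of a subsequence, and compactness follows. For (ii),
  condition (\<open>\<kappa>\<close>) and the monotonicity of \<open>G\<close> give back the hypothesis of (i).
\<close>

section \<open>Polar coordinates\<close>

text \<open>The derivative of \<open>G\<close> is in general not the density
  \<open>r \<sigma>(r)\<close> that polar coordinates produce, so \<open>G\<close> cannot serve as
  the variable of integration. \<open>T\<close> can, since the factor \<open>t\<close> in it is the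
  polar Jacobian. The estimate therefore runs with \<open>T\<close> and meets \<open>G\<close> only
  at its two ends: at \<open>z\<close>, near the boundary, where (W2) gives
  \<open>T \<le> C G\<close>, and at \<open>\<phi>(z)\<close>, which may lie anywhere, where the
  unconditional \<open>G \<le> T\<close> is the direction needed. Subordination requires the image
  of a whole disc, while the hypotheses speak of points near the boundary; inner points do no harm
  because their image stays in a compact subset of the disc. The price of subordination is a factor
  \<open>(\<rho> + |\<phi>(0)|) / (\<rho> - |\<phi>(0)|)\<close>, bounded only while \<rho> stays
  away from \<open>|\<phi>(0)|\<close>; this holds for \<open>r\<close> close to 1, because then
  \<open>T(r) / \<epsilon>\<close> is small and \<open>\<rho>(r)\<close> is close to 1. No constant
  depends on \<open>f\<close>, so one annulus serves all members of a bounded sequence.\<close>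

lemma measurable_Complex [measurable (raw)]:
  assumes [measurable]: "f \<in> borel_measurable M" "g \<in> borel_measurable M"
  shows "(\<lambda>x. Complex (f x) (g x)) \<in> borel_measurable M"
  unfolding Complex_eq by measurable

lemma lborel_complex_eq_distr:
  "(lborel :: complex measure) = distr (lborel \<Otimes>\<^sub>M lborel) borel (\<lambda>(x, y). Complex x y)"
proof (rule lborel_eqI)
  have m [measurable]: "(\<lambda>(x, y). Complex x y) \<in> borel_measurable (lborel \<Otimes>\<^sub>M lborel)"
    by measurable
  fix l u :: complex
  assume le: "\<And>b. b \<in> Basis \<Longrightarrow> l \<bullet> b \<le> u \<bullet> b"
  have le': "Re l \<le> Re u" "Im l \<le> Im u"
    using le[of 1] le[of \<i>] by (auto simp: Basis_complex_def)
  have "(\<lambda>(x, y). Complex x y) -` box l u = {Re l<..<Re u} \<times> {Im l<..<Im u}"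
    by (auto simp: box_def Basis_complex_def)
  then have "emeasure (distr (lborel \<Otimes>\<^sub>M lborel) borel (\<lambda>(x, y). Complex x y)) (box l u)
      = emeasure (lborel \<Otimes>\<^sub>M lborel) ({Re l<..<Re u} \<times> {Im l<..<Im u})"
    by (simp add: emeasure_distr space_pair_measure)
  also have "\<dots> = ennreal (Re u - Re l) * ennreal (Im u - Im l)"
    using le' by (simp add: lborel.emeasure_pair_measure_Times)
  also have "\<dots> = (\<Prod>b\<in>Basis. (u - l) \<bullet> b)"
    using le' by (simp add: Basis_complex_def ennreal_mult[symmetric])
  finally show "emeasure (distr (lborel \<Otimes>\<^sub>M lborel) borel (\<lambda>(x, y). Complex x y)) (box l u)
      = (\<Prod>b\<in>Basis. (u - l) \<bullet> b)" .
qed simp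

text \<open>Both orders of integration are kept because a shear is a translation only in the
  variable that it moves, and that variable has to be the inner one.\<close>

lemma nn_integral_lborel_complex:
  fixes h :: "complex \<Rightarrow> ennreal"
  assumes [measurable]: "h \<in> borel_measurable borel"
  shows "(\<integral>\<^sup>+ z. h z \<partial>lborel) = (\<integral>\<^sup>+ x. \<integral>\<^sup>+ y. h (Complex x y) \<partial>lborel \<partial>lborel)"
    and "(\<integral>\<^sup>+ z. h z \<partial>lborel) = (\<integral>\<^sup>+ y. \<integral>\<^sup>+ x. h (Complex x y) \<partial>lborel \<partial>lborel)"
proof -
  have eq: "(\<integral>\<^sup>+ z. h z \<partial>lborel) = (\<integral>\<^sup>+ (x, y). h (Complex x y) \<partial>(lborel \<Otimes>\<^sub>M lborel))"
    by (subst lborel_complex_eq_distr, subst nn_integral_distr) (auto simp: case_prod_unfold)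
  show "(\<integral>\<^sup>+ z. h z \<partial>lborel) = (\<integral>\<^sup>+ x. \<integral>\<^sup>+ y. h (Complex x y) \<partial>lborel \<partial>lborel)"
    unfolding eq by (subst lborel.nn_integral_fst[symmetric]) auto
  show "(\<integral>\<^sup>+ z. h z \<partial>lborel) = (\<integral>\<^sup>+ y. \<integral>\<^sup>+ x. h (Complex x y) \<partial>lborel \<partial>lborel)"
    unfolding eq by (subst lborel_pair.nn_integral_snd[symmetric]) auto
qed

text \<open>With the other coordinate fixed, a shear translates a line, and Lebesgue measure on the
  line is translation invariant.\<close>

lemma nn_integral_lborel_complex_shear:
  fixes h :: "complex \<Rightarrow> ennreal"
  assumes [measurable]: "h \<in> borel_measurable borel"
  shows "(\<integral>\<^sup>+ z. h (Complex (Re z + t * Im z) (Im z)) \<partial>lborel) = (\<integral>\<^sup>+ z. h z \<partial>lborel)"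
    and "(\<integral>\<^sup>+ z. h (Complex (Re z) (Im z + t * Re z)) \<partial>lborel) = (\<integral>\<^sup>+ z. h z \<partial>lborel)"
proof -
  have "(\<integral>\<^sup>+ x. h (Complex (x + t * y) y) \<partial>lborel) = (\<integral>\<^sup>+ x. h (Complex x y) \<partial>lborel)" for y
    using nn_integral_real_affine[of "\<lambda>x. h (Complex x y)" 1 "t * y"] by (simp add: add.commute)
  then show "(\<integral>\<^sup>+ z. h (Complex (Re z + t * Im z) (Im z)) \<partial>lborel) = (\<integral>\<^sup>+ z. h z \<partial>lborel)"
    by (simp add: nn_integral_lborel_complex(2))
  have "(\<integral>\<^sup>+ y. h (Complex x (y + t * x)) \<partial>lborel) = (\<integral>\<^sup>+ y. h (Complex x y) \<partial>lborel)" for x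
    using nn_integral_real_affine[of "\<lambda>y. h (Complex x y)" 1 "t * x"] by (simp add: add.commute)
  then show "(\<integral>\<^sup>+ z. h (Complex (Re z) (Im z + t * Re z)) \<partial>lborel) = (\<integral>\<^sup>+ z. h z \<partial>lborel)"
    by (simp add: nn_integral_lborel_complex(1))
qed

text \<open>A rotation by an angle other than \<open>\<pi>\<close> is a product of three shears.\<close>

lemma nn_integral_lborel_complex_rotate:
  fixes h :: "complex \<Rightarrow> ennreal"
  assumes h [measurable]: "h \<in> borel_measurable borel"
    and "norm w = 1" "w \<noteq> -1"
  shows "(\<integral>\<^sup>+ z. h (w * z) \<partial>lborel) = (\<integral>\<^sup>+ z. h z \<partial>lborel)"
proof -
  define c s where "c = Re w" and "s = Im w"
  have cs: "c\<^sup>2 + s\<^sup>2 = 1"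
    using assms(2) by (simp add: c_def s_def cmod_def)
  have c: "1 + c \<noteq> 0"
  proof
    assume "1 + c = 0"
    then have "c = -1" by simp
    moreover from this cs have "s = 0" by simp
    ultimately show False
      using assms(3) by (simp add: c_def s_def complex_eq_iff)
  qed
  \<comment> \<open>The tangent of half the rotation angle. It degenerates exactly at the excluded
    angle \<pi>.\<close>
  define t where "t = s / (1 + c)"
  have ts: "t * s = 1 - c"
    using c cs by (simp add: t_def field_simps power2_eq_square)
  have tc: "t * c = s - t"
    using c by (simp add: t_def field_simps)
  define A where "A = (\<lambda>z. Complex (Re z + (- t) * Im z) (Im z))"
  define B where "B = (\<lambda>z. Complex (Re z) (Im z + s * Re z))"
  have "A (B (A z)) = w * z" for z
  proof -
    have "Re z - t * Im z - t * (Im z + s * (Re z - t * Im z))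
        = Re z - 2 * t * Im z - (t * s) * Re z + (t * s) * t * Im z"
      by (simp add: algebra_simps)
    also have "\<dots> = c * Re z - (t + t * c) * Im z"
      unfolding ts by (simp add: algebra_simps)
    also have "\<dots> = c * Re z - s * Im z"
      unfolding tc by simp
    finally have 1: "Re z - t * Im z - t * (Im z + s * (Re z - t * Im z)) = c * Re z - s * Im z" .
    have "Im z + s * (Re z - t * Im z) = s * Re z + (1 - t * s) * Im z"
      by (simp add: algebra_simps)
    also have "\<dots> = s * Re z + c * Im z"
      unfolding ts by simp
    finally show ?thesis
      using 1 by (simp add: A_def B_def complex_eq_iff c_def s_def)
  qed
  then have "(\<integral>\<^sup>+ z. h (w * z) \<partial>lborel) = (\<integral>\<^sup>+ z. h (A (B (A z))) \<partial>lborel)"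
    by simp
  also have "\<dots> = (\<integral>\<^sup>+ z. h (A (B z)) \<partial>lborel)"
    using nn_integral_lborel_complex_shear(1)[of "\<lambda>z. h (A (B z))" "-t"]
    unfolding A_def B_def by simp
  also have "\<dots> = (\<integral>\<^sup>+ z. h (A z) \<partial>lborel)"
    using nn_integral_lborel_complex_shear(2)[of "\<lambda>z. h (A z)" s]
    unfolding A_def B_def by simp
  also have "\<dots> = (\<integral>\<^sup>+ z. h z \<partial>lborel)"
    unfolding A_def by (rule nn_integral_lborel_complex_shear(1)) (rule h)
  finally show ?thesis .
qed

section \<open>Averaging over angles, and polar coordinates\<close>

lemma nn_integral_periodic_shift:
  fixes k :: "real \<Rightarrow> ennreal"
  assumes [measurable]: "k \<in> borel_measurable borel"
    and per: "\<And>x. k (x + 1) = k x" and a: "0 \<le> a" "a < 1"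
  shows "(\<integral>\<^sup>+ x. k (x + a) * indicator {0..<1} x \<partial>lborel) = (\<integral>\<^sup>+ x. k x * indicator {0..<1} x \<partial>lborel)"
proof -
  have "(\<integral>\<^sup>+ x. k (x + a) * indicator {0..<1} x \<partial>lborel)
      = (\<integral>\<^sup>+ x. k x * indicator {a..<a + 1} x \<partial>lborel)"
    by (subst (2) nn_integral_real_affine[where c = 1 and t = a])
      (auto intro!: nn_integral_cong simp: add.commute split: split_indicator)
  also have "\<dots> = (\<integral>\<^sup>+ x. k x * indicator {a..<1} x + k x * indicator {1..<a + 1} x \<partial>lborel)"
    using a by (auto intro!: nn_integral_cong split: split_indicator)
  also have "\<dots> = (\<integral>\<^sup>+ x. k x * indicator {a..<1} x \<partial>lborel)
      + (\<integral>\<^sup>+ x. k x * indicator {1..<a + 1} x \<partial>lborel)"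
    by (rule nn_integral_add) auto
  also have "(\<integral>\<^sup>+ x. k x * indicator {1..<a + 1} x \<partial>lborel)
      = (\<integral>\<^sup>+ x. k x * indicator {0..<a} x \<partial>lborel)"
    by (subst nn_integral_real_affine[where c = 1 and t = 1])
      (auto intro!: nn_integral_cong simp: per add.commute[of 1] split: split_indicator)
  also have "(\<integral>\<^sup>+ x. k x * indicator {a..<1} x \<partial>lborel) + (\<integral>\<^sup>+ x. k x * indicator {0..<a} x \<partial>lborel)
      = (\<integral>\<^sup>+ x. k x * indicator {a..<1} x + k x * indicator {0..<a} x \<partial>lborel)"
    by (rule nn_integral_add[symmetric]) auto
  also have "\<dots> = (\<integral>\<^sup>+ x. k x * indicator {0..<1} x \<partial>lborel)"
    using a by (auto intro!: nn_integral_cong split: split_indicator)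
  finally show ?thesis .
qed

lemma nn_integral_Icc_Ico:
  fixes f :: "real \<Rightarrow> ennreal"
  shows "(\<integral>\<^sup>+ x. f x * indicator {a..b} x \<partial>lborel) = (\<integral>\<^sup>+ x. f x * indicator {a..<b} x \<partial>lborel)"
proof (rule nn_integral_cong_AE)
  show "AE x in lborel. f x * indicator {a..b} x = f x * indicator {a..<b} x"
    using AE_lborel_singleton[of b] by eventually_elim (auto split: split_indicator)
qed

lemma measurable_cis [measurable]: "cis \<in> borel_measurable borel"
  by (intro borel_measurable_continuous_onI continuous_intros)

text \<open>Rotation invariance is averaged over all angles, counted in full turns \<open>t\<close>,
  and the integrals are exchanged. For fixed \<open>z\<close> the function of \<open>t\<close> has
  period 1, so the argument of \<open>z\<close> is a mere shift of \<open>t\<close> and only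
  \<open>norm z\<close> survives.\<close>

lemma nn_integral_lborel_complex_average:
  fixes h :: "complex \<Rightarrow> ennreal"
  assumes h [measurable]: "h \<in> borel_measurable borel"
  shows "(\<integral>\<^sup>+ z. h z \<partial>lborel)
    = (\<integral>\<^sup>+ z. (\<integral>\<^sup>+ t. h (of_real (norm (z::complex)) * cis (2 * pi * t)) * indicator {0..1} t \<partial>lborel) \<partial>lborel)"
proof -
  let ?e = "\<lambda>t::real. cis (2 * pi * t)"
  have "(\<integral>\<^sup>+ z. h z \<partial>lborel) = (\<integral>\<^sup>+ t. (\<integral>\<^sup>+ z. h z \<partial>lborel) * indicator {0..<1::real} t \<partial>lborel)"
    by (subst nn_integral_cmult) auto
  also have "\<dots> = (\<integral>\<^sup>+ t. (\<integral>\<^sup>+ z. h (?e t * z) * indicator {0..<1} t \<partial>lborel) \<partial>lborel)"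
  proof (rule nn_integral_cong_AE)
    show "AE t in lborel. (\<integral>\<^sup>+ z. h z \<partial>lborel) * indicator {0..<1} t
        = (\<integral>\<^sup>+ z. h (?e t * z) * indicator {0..<1} t \<partial>lborel)"
      \<comment> \<open>Half a turn is the one rotation that the three shears do not reach; it is a
        null set of angles.\<close>
      using AE_lborel_singleton[of "1/2"]
    proof eventually_elim
      case (elim t)
      have "?e t \<noteq> -1" if t: "t \<in> {0..<1}"
      proof
        assume "?e t = -1"
        then have "cis (2 * pi * t - pi) = 1"
          by (simp add: cis_divide[symmetric])
        then have "cos (2 * pi * t - pi) = 1"
          by (metis cis.simps(1) one_complex.simps(1))
        then obtain n :: int where "2 * pi * t - pi = of_int n * 2 * pi"
          using cos_one_2pi_int by blast
        then have "pi * (2 * t - 1) = pi * (2 * of_int n)"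
          by (simp add: algebra_simps)
        then have "2 * t - 1 = 2 * of_int n"
          by (subst (asm) mult_cancel_left) auto
        moreover from this t have "real_of_int n < 1" "real_of_int n > -1" by auto
        then have "n = 0" by linarith
        ultimately show False using elim by simp
      qed
      then show ?case
        using nn_integral_lborel_complex_rotate[OF h, of "?e t"]
        by (simp add: nn_integral_multc split: split_indicator)
    qed
  qed
  also have "\<dots> = (\<integral>\<^sup>+ z. (\<integral>\<^sup>+ t. h (?e t * z) * indicator {0..<1} t \<partial>lborel) \<partial>lborel)"
    by (rule lborel_pair.Fubini') measurable
  also have "\<dots> = (\<integral>\<^sup>+ z. (\<integral>\<^sup>+ t. h (norm (z::complex) * ?e t) * indicator {0..1} t \<partial>lborel) \<partial>lborel)"
  proof (rule nn_integral_cong)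
    fix z :: complex
    define a where "a = Arg2pi z / (2 * pi)"
    have a: "0 \<le> a" "a < 1"
      using Arg2pi[of z] by (auto simp: a_def)
    have "z = norm z * ?e a"
      using Arg2pi_eq[of z] by (simp add: a_def cis_conv_exp)
    then have "?e t * z = norm z * (?e t * ?e a)" for t
      by (metis mult.left_commute)
    then have "h (?e t * z) = h (norm z * ?e (t + a))" for t
      by (simp add: distrib_left cis_mult)
    then have "(\<integral>\<^sup>+ t. h (?e t * z) * indicator {0..<1} t \<partial>lborel)
        = (\<integral>\<^sup>+ t. h (norm z * ?e (t + a)) * indicator {0..<1} t \<partial>lborel)"
      by simp
    also have "\<dots> = (\<integral>\<^sup>+ t. h (norm z * ?e t) * indicator {0..<1} t \<partial>lborel)"
    proof (rule nn_integral_periodic_shift[OF _ _ a])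
      show "h (norm z * ?e (x + 1)) = h (norm z * ?e x)" for x
        by (simp add: distrib_left cis_mult[symmetric])
    qed measurable
    finally show "(\<integral>\<^sup>+ t. h (?e t * z) * indicator {0..<1} t \<partial>lborel)
        = (\<integral>\<^sup>+ t. h (norm (z::complex) * ?e t) * indicator {0..1} t \<partial>lborel)"
      by (simp add: nn_integral_Icc_Ico)
  qed
  finally show ?thesis .
qed

text \<open>Two measures on the line with equal finite values on all half-lines
  \<open>{x<..}\<close> coincide. Here they are the image of area under \<open>norm\<close> and the
  density \<open>2 * pi * r\<close>, and for \<open>x\<close> in \<open>{0..<1}\<close> the common
  value is the area of an annulus.\<close>

lemma nn_integral_unit_ball_radial:
  fixes g :: "real \<Rightarrow> ennreal"
  assumes [measurable]: "g \<in> borel_measurable borel"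
  shows "(\<integral>\<^sup>+ z. g (norm (z::complex)) * indicator (ball 0 1) z \<partial>lborel)
    = (\<integral>\<^sup>+ r. ennreal (2 * pi * r) * g r * indicator {0<..<1} r \<partial>lborel)"
proof -
  define M where "M = distr (density lborel (indicator (ball (0::complex) 1))) borel norm"
  define N where "N = density lborel (\<lambda>r. ennreal (2 * pi * r) * indicator {0<..<1::real} r)"
  have 1: "emeasure M {x<..} = emeasure lborel (norm -` {x<..} \<inter> ball (0::complex) 1)" for x
  proof -
    have "open (norm -` {x<..} :: complex set)"
      by (intro continuous_open_vimage) auto
    then have [measurable]: "norm -` {x<..} \<in> sets (borel :: complex measure)"
      by (rule borel_open)
    have [measurable]: "ball (0::complex) 1 \<in> sets borel"
      by simp
    have "emeasure M {x<..} = emeasure (density lborel (indicator (ball (0::complex) 1))) (norm -` {x<..})"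
      unfolding M_def by (simp add: emeasure_distr)
    also have "\<dots> = (\<integral>\<^sup>+ z. indicator (ball (0::complex) 1) z * indicator (norm -` {x<..}) z \<partial>lborel)"
      by (subst emeasure_density) auto
    also have "\<dots> = (\<integral>\<^sup>+ z. indicator (norm -` {x<..} \<inter> ball (0::complex) 1) z \<partial>lborel)"
      by (intro nn_integral_cong) (auto split: split_indicator)
    finally show ?thesis by simp
  qed
  have M: "emeasure M {x<..} = ennreal (pi * (1 - (max x 0)\<^sup>2))" if "x < 1" for x
  proof -
    show ?thesis
    proof (cases "x < 0")
      case True
      then have "norm -` {x<..} \<inter> ball (0::complex) 1 = ball 0 1"
        by (auto intro: less_le_trans[OF _ norm_ge_zero])
      then show ?thesis using 1[of x] True
        by (simp add: emeasure_ball unit_ball_vol_2)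
    next
      case False
      then have "norm -` {x<..} \<inter> ball (0::complex) 1 = ball 0 1 - cball 0 x"
        by auto
      moreover have "emeasure lborel (ball 0 1 - cball (0::complex) x)
          = emeasure lborel (ball (0::complex) 1) - emeasure lborel (cball (0::complex) x)"
        using that False by (intro emeasure_Diff) (auto simp: emeasure_cball)
      moreover have "x\<^sup>2 \<le> 1"
        using that False by (simp add: power_le_one)
      ultimately show ?thesis using 1[of x] False that
        by (simp add: emeasure_ball emeasure_cball unit_ball_vol_2 ennreal_minus max_def algebra_simps)
    qed
  qed
  have N: "emeasure N {x<..} = ennreal (pi * (1 - (max x 0)\<^sup>2))" if "x < 1" for x
  proof -
    have "emeasure N {x<..}
        = (\<integral>\<^sup>+ r. ennreal (2 * pi * r) * indicator {0<..<1} r * indicator {x<..} r \<partial>lborel)"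
      unfolding N_def by (subst emeasure_density) auto
    also have "\<dots> = (\<integral>\<^sup>+ r. ennreal (2 * pi * r) * indicator {max x 0..1} r \<partial>lborel)"
    proof (rule nn_integral_cong_AE)
      show "AE r in lborel. ennreal (2 * pi * r) * indicator {0<..<1} r * indicator {x<..} r
          = ennreal (2 * pi * r) * indicator {max x 0..1} r"
        using AE_lborel_singleton[of 1] AE_lborel_singleton[of "max x 0"]
        by eventually_elim (auto split: split_indicator)
    qed
    also have "\<dots> = ennreal (pi * 1\<^sup>2 - pi * (max x 0)\<^sup>2)"
      using that
      by (intro nn_integral_FTC_Icc) (auto intro!: derivative_eq_intros)
    finally show ?thesis by (simp add: algebra_simps)
  qed
  have M1: "emeasure M {x<..} = 0" if "x \<ge> 1" for x
  proof -
    have "norm -` {x<..} \<inter> ball (0::complex) 1 = {}"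
      using that by auto
    then show ?thesis
      using 1[of x] by simp
  qed
  have N1: "emeasure N {x<..} = 0" if "x \<ge> 1" for x
    unfolding N_def using that
    by (auto simp: emeasure_density nn_integral_0_iff_AE split: split_indicator)
  have MN: "M = N"
  proof (rule measure_eqI_lessThan)
    fix x :: real
    show "emeasure M {x<..} < \<infinity>"
      by (cases "x < 1") (auto simp: M M1)
    show "emeasure M {x<..} = emeasure N {x<..}"
      by (cases "x < 1") (auto simp: M M1 N N1)
  qed (auto simp: M_def N_def)
  have [measurable]: "ball (0::complex) 1 \<in> sets borel"
    by simp
  have "(\<integral>\<^sup>+ z. g (norm (z::complex)) * indicator (ball 0 1) z \<partial>lborel) = integral\<^sup>N M g"
    unfolding M_def by (simp add: nn_integral_distr nn_integral_density mult.commute)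
  also have "\<dots> = (\<integral>\<^sup>+ r. ennreal (2 * pi * r) * g r * indicator {0<..<1} r \<partial>lborel)"
    unfolding MN N_def by (simp add: nn_integral_density ac_simps)
  finally show ?thesis .
qed

lemma nn_integral_unit_ball_polar:
  fixes h :: "complex \<Rightarrow> ennreal"
  assumes h [measurable]: "h \<in> borel_measurable borel"
  shows "(\<integral>\<^sup>+ z. h z * indicator (ball 0 1) z \<partial>lborel)
    = (\<integral>\<^sup>+ r. ennreal (2 * pi * r)
        * (\<integral>\<^sup>+ t. h (of_real r * cis (2 * pi * t)) * indicator {0..1} t \<partial>lborel)
        * indicator {0<..<1} r \<partial>lborel)"
proof -
  let ?H = "\<lambda>r. \<integral>\<^sup>+ t. h (of_real r * cis (2 * pi * t)) * indicator {0..1} t \<partial>lborel"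
  have [measurable]: "ball (0::complex) 1 \<in> sets borel"
    by simp
  have "(\<integral>\<^sup>+ z. h z * indicator (ball 0 1) z \<partial>lborel)
    = (\<integral>\<^sup>+ z. (\<integral>\<^sup>+ t. h (of_real (norm (z::complex)) * cis (2 * pi * t))
        * indicator (ball 0 1) (of_real (norm z) * cis (2 * pi * t)) * indicator {0..1} t \<partial>lborel) \<partial>lborel)"
    by (rule nn_integral_lborel_complex_average) measurable
  also have "\<dots> = (\<integral>\<^sup>+ z. ?H (norm (z::complex)) * indicator (ball 0 1) z \<partial>lborel)"
    by (intro nn_integral_cong) (auto simp: norm_mult split: split_indicator)
  also have "\<dots> = (\<integral>\<^sup>+ r. ennreal (2 * pi * r) * ?H r * indicator {0<..<1} r \<partial>lborel)"
    by (rule nn_integral_unit_ball_radial) measurable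
  finally show ?thesis .
qed

section \<open>Littlewood subordination\<close>

text \<open>On \<open>circlepath\<close> the derivative is \<open>2 * pi * \<i>\<close> times the
  point itself, so Cauchy's formula becomes an average with weight
  \<open>\<zeta> / (\<zeta> - w)\<close>. At \<open>w = 0\<close> this weight is 1, which is the
  mean value property.\<close>

lemma holomorphic_mean_value_Cauchy:
  assumes "f holomorphic_on cball 0 \<rho>" "0 < \<rho>" "norm w < \<rho>"
  shows "((\<lambda>t. f (of_real \<rho> * cis (2 * pi * t)) * (of_real \<rho> * cis (2 * pi * t))
            / (of_real \<rho> * cis (2 * pi * t) - w)) has_integral f w) {0..1}"
proof -
  have "((\<lambda>u. f u / (u - w)) has_contour_integral 2 * of_real pi * \<i> * f w) (circlepath 0 \<rho>)"
    using Cauchy_integral_circlepath_simple[OF assms(1), of w] assms by simp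
  then have "((\<lambda>t. f (circlepath 0 \<rho> t) / (circlepath 0 \<rho> t - w)
      * (2 * pi * \<i> * \<rho> * exp (2 * of_real pi * \<i> * t))) has_integral 2 * of_real pi * \<i> * f w) {0..1}"
    unfolding has_contour_integral_def
    by (rule has_integral_eq[rotated]) (simp add: vector_derivative_circlepath01)
  then have "((\<lambda>t. (f (circlepath 0 \<rho> t) / (circlepath 0 \<rho> t - w)
      * (2 * pi * \<i> * \<rho> * exp (2 * of_real pi * \<i> * t))) * (1 / (2 * of_real pi * \<i>)))
      has_integral 2 * of_real pi * \<i> * f w * (1 / (2 * of_real pi * \<i>))) {0..1}"
    by (rule has_integral_mult_left)
  moreover have "exp (2 * of_real pi * \<i> * of_real t) = cis (2 * pi * t)" for t
    by (simp add: cis_conv_exp mult_ac)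
  ultimately show ?thesis
    by (simp add: circlepath field_simps)
qed

lemma holomorphic_mean_value:
  assumes "f holomorphic_on cball 0 \<rho>" "0 < \<rho>"
  shows "((\<lambda>t. f (of_real \<rho> * cis (2 * pi * t))) has_integral f 0) {0..1}"
  using holomorphic_mean_value_Cauchy[OF assms, of 0] assms(2) by simp

text \<open>The radius of the circle is read off from \<zeta>, so one kernel serves every circle
  around 0. It is normalised to have mean 1 over the circle, for \<open>w\<close> inside.\<close>

definition poisson_kernel :: "complex \<Rightarrow> complex \<Rightarrow> real" where
  "poisson_kernel \<zeta> w = ((norm \<zeta>)\<^sup>2 - (norm w)\<^sup>2) / (norm (\<zeta> - w))\<^sup>2"

lemma poisson_kernel_nonneg: "norm w \<le> norm \<zeta> \<Longrightarrow> 0 \<le> poisson_kernel \<zeta> w"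
  by (simp add: poisson_kernel_def power_mono)

text \<open>Harnack's upper bound: the reverse triangle inequality bounds the denominator from
  below, and one factor of the difference of squares cancels. At \<open>w = \<phi> 0\<close> it is
  the constant in the subordination estimate.\<close>

lemma poisson_kernel_le:
  assumes "norm w < norm \<zeta>"
  shows "poisson_kernel \<zeta> w \<le> (norm \<zeta> + norm w) / (norm \<zeta> - norm w)"
proof -
  have "(norm \<zeta> - norm w)\<^sup>2 \<le> (norm (\<zeta> - w))\<^sup>2"
    using assms by (intro power_mono norm_triangle_ineq2) auto
  then have "poisson_kernel \<zeta> w \<le> ((norm \<zeta>)\<^sup>2 - (norm w)\<^sup>2) / (norm \<zeta> - norm w)\<^sup>2"
    unfolding poisson_kernel_def using assms
    by (intro divide_left_mono) (auto simp: power_mono intro!: mult_pos_pos)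
  also have "\<dots> = (norm \<zeta> + norm w) / (norm \<zeta> - norm w)"
    using assms by (simp add: power2_eq_square square_diff_square_factored)
  finally show ?thesis .
qed

text \<open>This form shows the kernel as the real part of a function holomorphic in
  \<open>w\<close>, a property that composition with a holomorphic map preserves.\<close>

lemma poisson_kernel_eq_Re: "poisson_kernel \<zeta> w = Re ((\<zeta> + w) / (\<zeta> - w))"
proof -
  have "(norm \<zeta>)\<^sup>2 - (norm w)\<^sup>2 = Re (\<zeta> + w) * Re (\<zeta> - w) + Im (\<zeta> + w) * Im (\<zeta> - w)"
    unfolding cmod_power2 by (simp add: power2_eq_square algebra_simps)
  then show ?thesis
    by (simp only: poisson_kernel_def Re_divide cmod_power2[of "\<zeta> - w"])
qed

lemma continuous_on_poisson_kernel [continuous_intros]: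
  assumes "continuous_on S f" "continuous_on S g" "\<And>x. x \<in> S \<Longrightarrow> f x \<noteq> g x"
  shows "continuous_on S (\<lambda>x. poisson_kernel (f x) (g x))"
  unfolding poisson_kernel_def using assms by (intro continuous_intros) auto

text \<open>Cauchy's formula for \<open>f(\<zeta>)\<^sup>2 (\<rho>\<^sup>2 - |w|\<^sup>2) / (\<rho>\<^sup>2 - cnj w \<zeta>)\<close>, whose Cauchy integrand on the circle
  is \<open>f\<^sup>2\<close> times the Poisson kernel.\<close>

lemma norm_square_le_poisson_integral:
  assumes hol: "f holomorphic_on cball 0 \<rho>" and \<rho>: "0 < \<rho>" and w: "norm w < \<rho>"
  shows "ennreal ((norm (f w))\<^sup>2) \<le> (\<integral>\<^sup>+ t. ennreal ((norm (f (of_real \<rho> * cis (2 * pi * t))))\<^sup>2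
      * poisson_kernel (of_real \<rho> * cis (2 * pi * t)) w) * indicator {0..1} t \<partial>lborel)"
proof -
  let ?z = "\<lambda>t::real. of_real \<rho> * cis (2 * pi * t)"
  let ?F = "\<lambda>t. (norm (f (?z t)))\<^sup>2 * poisson_kernel (?z t) w"
  define g where "g = (\<lambda>\<zeta>. (f \<zeta>)\<^sup>2 * (\<rho>\<^sup>2 - (norm w)\<^sup>2) / (\<rho>\<^sup>2 - cnj w * \<zeta>))"
  have ne: "of_real (\<rho>\<^sup>2) \<noteq> cnj w * \<zeta>" if "norm \<zeta> \<le> \<rho>" for \<zeta>
  proof
    assume "of_real (\<rho>\<^sup>2) = cnj w * \<zeta>"
    then have "norm (of_real (\<rho>\<^sup>2) :: complex) = norm w * norm \<zeta>"
      by (simp add: norm_mult)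
    moreover have "norm w * norm \<zeta> \<le> norm w * \<rho>"
      using that by (intro mult_left_mono) auto
    moreover have "norm w * \<rho> < \<rho> * \<rho>"
      using w \<rho> by simp
    ultimately show False
      by (simp add: power2_eq_square norm_mult)
  qed
  have "g holomorphic_on cball 0 \<rho>"
    unfolding g_def using ne by (intro holomorphic_intros hol) auto
  from holomorphic_mean_value_Cauchy[OF this \<rho> w]
  have I: "((\<lambda>t. g (?z t) * ?z t / (?z t - w)) has_integral g w) {0..1}" .
  have nz: "norm (?z t) = \<rho>" for t
    using \<rho> by (simp add: norm_mult)
  have nw: "?z t \<noteq> w" for t
    using nz[of t] w by auto
  have eq: "g (?z t) * ?z t / (?z t - w) = (f (?z t))\<^sup>2 * of_real (poisson_kernel (?z t) w)" for t
  proof -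
    \<comment> \<open>On the circle this turns the denominator of \<open>g\<close> into
      \<open>\<zeta> * cnj (\<zeta> - w)\<close>. The factor \<zeta> cancels against the Cauchy
      weight, and the conjugate completes \<open>\<zeta> - w\<close> to the squared norm in the
      Poisson kernel.\<close>
    have zz: "of_real (\<rho>\<^sup>2) = ?z t * cnj (?z t)"
      using nz[of t] complex_norm_square[of "?z t"] by simp
    have "of_real (\<rho>\<^sup>2) - cnj w * ?z t = ?z t * cnj (?z t - w)"
      unfolding zz by (simp add: algebra_simps)
    moreover have "?z t \<noteq> 0" using nz[of t] \<rho> by auto
    ultimately have "g (?z t) * ?z t / (?z t - w)
        = (f (?z t))\<^sup>2 * of_real (\<rho>\<^sup>2 - (norm w)\<^sup>2) / (cnj (?z t - w) * (?z t - w))"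
      unfolding g_def using nw[of t] by (simp add: divide_simps)
    also have "cnj (?z t - w) * (?z t - w) = of_real ((norm (?z t - w))\<^sup>2)"
      by (subst complex_norm_square) (simp add: mult.commute)
    finally show ?thesis
      by (simp add: poisson_kernel_def nz)
  qed
  have cf: "continuous_on UNIV (\<lambda>t. f (?z t))"
    by (rule continuous_on_compose2[OF holomorphic_on_imp_continuous_on[OF hol]])
      (auto simp: nz intro!: continuous_intros)
  have cF: "continuous_on UNIV ?F"
    using nw by (intro continuous_intros cf) auto
  have F0: "0 \<le> ?F t" for t
    using w by (simp add: poisson_kernel_nonneg nz)
  have IF: "?F integrable_on {0..1}"
    by (rule integrable_continuous_interval) (rule continuous_on_subset[OF cF], simp)
  \<comment> \<open>At \<open>\<zeta> = w\<close> the factor attached to the square of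
    \<open>f\<close> equals 1, so Cauchy's formula still reproduces that square.\<close>
  have gw: "g w = (f w)\<^sup>2"
  proof -
    have "\<rho>\<^sup>2 - (norm w)\<^sup>2 \<noteq> 0"
      using w \<rho> by (simp add: power2_eq_iff_nonneg)
    then have "of_real (\<rho>\<^sup>2 - (norm w)\<^sup>2) \<noteq> (0::complex)"
      using of_real_eq_0_iff by blast
    moreover have "of_real (\<rho>\<^sup>2) - cnj w * w = (of_real (\<rho>\<^sup>2 - (norm w)\<^sup>2) :: complex)"
      using complex_norm_square[of w] by (simp add: mult.commute)
    ultimately show ?thesis
      unfolding g_def by simp
  qed
  have "(norm (f w))\<^sup>2 = norm (integral {0..1} (\<lambda>t. g (?z t) * ?z t / (?z t - w)))"
    using I by (simp add: integral_unique gw norm_power)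
  also have "\<dots> \<le> integral {0..1} ?F"
  proof (rule integral_norm_bound_integral)
    show "norm (g (?z t) * ?z t / (?z t - w)) \<le> ?F t" for t
      unfolding eq using poisson_kernel_nonneg[of w "?z t"] w
      unfolding nz by (simp add: norm_mult norm_power)
  qed (use I IF in auto)
  finally have "ennreal ((norm (f w))\<^sup>2) \<le> ennreal (integral {0..1} ?F)"
    by (rule ennreal_leI)
  also have "\<dots> = (\<integral>\<^sup>+ t. ennreal (?F t) * indicator {0..1} t \<partial>lborel)"
    using F0 integrable_integral[OF IF] by (intro nn_integral_has_integral_lebesgue'[symmetric]) auto
  finally show ?thesis .
qed

text \<open>Since \<phi> avoids \<zeta>, the quotient
  \<open>(\<zeta> + \<phi> z) / (\<zeta> - \<phi> z)\<close> is holomorphic; its real part is the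
  kernel, and the mean value property applies.\<close>

lemma nn_integral_poisson_kernel_comp:
  assumes hol: "\<phi> holomorphic_on cball 0 r" and r: "0 < r"
    and le: "\<And>z. z \<in> cball 0 r \<Longrightarrow> norm (\<phi> z) < norm \<zeta>"
  shows "(\<integral>\<^sup>+ t. ennreal (poisson_kernel \<zeta> (\<phi> (of_real r * cis (2 * pi * t)))) * indicator {0..1} t \<partial>lborel)
    = ennreal (poisson_kernel \<zeta> (\<phi> 0))"
proof -
  let ?z = "\<lambda>t::real. of_real r * cis (2 * pi * t)"
  have ne: "\<phi> z \<noteq> \<zeta>" if "z \<in> cball 0 r" for z
    using le[OF that] by auto
  have zr: "?z t \<in> cball 0 r" for t
    using r by (simp add: norm_mult)
  have "((\<lambda>t. (\<zeta> + \<phi> (?z t)) / (\<zeta> - \<phi> (?z t))) has_integral (\<zeta> + \<phi> 0) / (\<zeta> - \<phi> 0)) {0..1}"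
  proof (rule holomorphic_mean_value[OF _ r])
    show "(\<lambda>z. (\<zeta> + \<phi> z) / (\<zeta> - \<phi> z)) holomorphic_on cball 0 r"
      using ne by (intro holomorphic_intros hol) auto
  qed
  then have "((\<lambda>t. Re ((\<zeta> + \<phi> (?z t)) / (\<zeta> - \<phi> (?z t)))) has_integral Re ((\<zeta> + \<phi> 0) / (\<zeta> - \<phi> 0))) {0..1}"
    by (rule has_integral_Re)
  then have "((\<lambda>t. poisson_kernel \<zeta> (\<phi> (?z t))) has_integral poisson_kernel \<zeta> (\<phi> 0)) {0..1}"
    using le zr r by (simp add: poisson_kernel_eq_Re)
  then show ?thesis
    using le zr by (intro nn_integral_has_integral_lebesgue') (auto intro!: poisson_kernel_nonneg less_imp_le[of "norm _"])
qed

definition circle_mean_square :: "(complex \<Rightarrow> complex) \<Rightarrow> real \<Rightarrow> ennreal" where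
  "circle_mean_square f r =
     (\<integral>\<^sup>+ t. ennreal ((norm (f (of_real r * cis (2 * pi * t))))\<^sup>2) * indicator {0..1} t \<partial>lborel)"

text \<open>Littlewood's subordination principle: the Poisson majorant of \<open>|f|\<^sup>2\<close> stays harmonic after
  composition with \<open>\<phi>\<close>, so its circle means equal its value at \<open>\<phi> 0\<close>.\<close>

lemma circle_mean_square_comp_le:
  assumes f: "f holomorphic_on cball 0 \<rho>" and \<phi>: "\<phi> holomorphic_on cball 0 r" and r: "0 < r"
    and le: "\<And>z. z \<in> cball 0 r \<Longrightarrow> norm (\<phi> z) < \<rho>"
  shows "circle_mean_square (f \<circ> \<phi>) r
    \<le> ennreal ((\<rho> + norm (\<phi> 0)) / (\<rho> - norm (\<phi> 0))) * circle_mean_square f \<rho>"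
proof -
  let ?z = "\<lambda>t::real. of_real r * cis (2 * pi * t)"
  let ?w = "\<lambda>t::real. of_real \<rho> * cis (2 * pi * t)"
  define K where "K = (\<rho> + norm (\<phi> 0)) / (\<rho> - norm (\<phi> 0))"
  have \<rho>0: "norm (\<phi> 0) < \<rho>"
    using le[of 0] r by simp
  then have \<rho>: "0 < \<rho>"
    using norm_ge_zero[of "\<phi> 0"] by linarith
  have zr: "?z t \<in> cball 0 r" for t
    using r by (simp add: norm_mult)
  have nw: "norm (?w s) = \<rho>" for s
    using \<rho> by (simp add: norm_mult)
  have cf: "continuous_on UNIV (\<lambda>p. f (?w (snd p)))"
    by (rule continuous_on_compose2[OF holomorphic_on_imp_continuous_on[OF f]])
      (auto simp: nw intro!: continuous_intros)
  have c\<phi>: "continuous_on UNIV (\<lambda>p. \<phi> (?z (fst p)))"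
    using zr by (intro continuous_on_compose2[OF holomorphic_on_imp_continuous_on[OF \<phi>]])
      (auto intro!: continuous_intros)
  define P where "P = (\<lambda>t s. (norm (f (?w s)))\<^sup>2 * poisson_kernel (?w s) (\<phi> (?z t)))"
  have ne: "?w s \<noteq> \<phi> (?z t)" for s t
    using le[OF zr[of t]] nw[of s] by auto
  have "continuous_on UNIV (\<lambda>p. P (fst p) (snd p))"
    unfolding P_def using ne by (intro continuous_intros cf c\<phi>) auto
  then have "(\<lambda>p. P (fst p) (snd p)) \<in> borel_measurable (borel \<Otimes>\<^sub>M borel)"
    unfolding borel_prod by (rule borel_measurable_continuous_onI)
  then have P [measurable]: "(\<lambda>(t, s). P t s) \<in> borel_measurable (borel \<Otimes>\<^sub>M borel)"
    by (simp add: case_prod_unfold)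
  have "circle_mean_square (f \<circ> \<phi>) r
      \<le> (\<integral>\<^sup>+ t. (\<integral>\<^sup>+ s. ennreal (P t s) * indicator {0..1} s \<partial>lborel) * indicator {0..1} t \<partial>lborel)"
    unfolding circle_mean_square_def P_def o_def
    by (intro nn_integral_mono mult_right_mono norm_square_le_poisson_integral[OF f \<rho>] le zr) auto
  also have "\<dots> = (\<integral>\<^sup>+ t. (\<integral>\<^sup>+ s. ennreal (P t s) * indicator {0..1} s * indicator {0..1} t \<partial>lborel) \<partial>lborel)"
    by (simp add: nn_integral_multc)
  also have "\<dots> = (\<integral>\<^sup>+ s. (\<integral>\<^sup>+ t. ennreal (P t s) * indicator {0..1} s * indicator {0..1} t \<partial>lborel) \<partial>lborel)"
    by (rule lborel_pair.Fubini') measurable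
  \<comment> \<open>With \<open>s\<close> fixed, the inner mean of the kernel is its value at
    \<open>\<phi> 0\<close>, and Harnack's bound replaces that value by \<open>K\<close>, which does
    not depend on \<open>s\<close>.\<close>
  also have "\<dots> \<le> (\<integral>\<^sup>+ s. ennreal K * (ennreal ((norm (f (?w s)))\<^sup>2) * indicator {0..1} s) \<partial>lborel)"
  proof (rule nn_integral_mono)
    fix s :: real
    have "continuous_on UNIV (\<lambda>t. poisson_kernel (?w s) (\<phi> (?z t)))"
      using ne continuous_on_compose2[OF c\<phi>, of UNIV "\<lambda>t. (t, 0)"]
      by (intro continuous_intros) (auto simp: continuous_on_Pair)
    then have [measurable]: "(\<lambda>t. poisson_kernel (?w s) (\<phi> (?z t))) \<in> borel_measurable borel"
      by (rule borel_measurable_continuous_onI)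
    have "(\<integral>\<^sup>+ t. ennreal (P t s) * indicator {0..1} s * indicator {0..1} t \<partial>lborel)
        = (\<integral>\<^sup>+ t. (ennreal ((norm (f (?w s)))\<^sup>2) * indicator {0..1} s)
            * (ennreal (poisson_kernel (?w s) (\<phi> (?z t))) * indicator {0..1} t) \<partial>lborel)"
      unfolding P_def by (intro nn_integral_cong) (simp add: ennreal_mult' mult_ac)
    also have "\<dots> = (ennreal ((norm (f (?w s)))\<^sup>2) * indicator {0..1} s)
            * (\<integral>\<^sup>+ t. ennreal (poisson_kernel (?w s) (\<phi> (?z t))) * indicator {0..1} t \<partial>lborel)"
      by (rule nn_integral_cmult) measurable
    also have "(\<integral>\<^sup>+ t. ennreal (poisson_kernel (?w s) (\<phi> (?z t))) * indicator {0..1} t \<partial>lborel)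
        = ennreal (poisson_kernel (?w s) (\<phi> 0))"
      by (rule nn_integral_poisson_kernel_comp[OF \<phi> r]) (simp only: nw le)
    also have "(ennreal ((norm (f (?w s)))\<^sup>2) * indicator {0..1} s) * ennreal (poisson_kernel (?w s) (\<phi> 0))
        \<le> (ennreal ((norm (f (?w s)))\<^sup>2) * indicator {0..1} s) * ennreal K"
      using poisson_kernel_le[of "\<phi> 0" "?w s"] \<rho>0 unfolding nw K_def
      by (intro mult_left_mono ennreal_leI) auto
    finally show "(\<integral>\<^sup>+ t. ennreal (P t s) * indicator {0..1} s * indicator {0..1} t \<partial>lborel)
        \<le> ennreal K * (ennreal ((norm (f (?w s)))\<^sup>2) * indicator {0..1} s)"
      by (simp only: mult.commute[of _ "ennreal K"])
  qed
  also have "\<dots> = ennreal K * circle_mean_square f \<rho>"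
    unfolding circle_mean_square_def
  proof (rule nn_integral_cmult)
    have "continuous_on UNIV (\<lambda>s. f (?w s))"
      using continuous_on_compose2[OF cf, of UNIV "\<lambda>s. (0, s)"] by (auto simp: continuous_on_Pair)
    then have [measurable]: "(\<lambda>s. f (?w s)) \<in> borel_measurable borel"
      by (rule borel_measurable_continuous_onI)
    show "(\<lambda>s. ennreal ((norm (f (?w s)))\<^sup>2) * indicator {0..1} s) \<in> borel_measurable lborel"
      by measurable
  qed
  finally show ?thesis
    unfolding K_def .
qed

text \<open>Subordination for the constant map with value \<open>w\<close>: the mean of a constant
  is that constant.\<close>

lemma norm_square_le_circle_mean_square:
  assumes f: "f holomorphic_on cball 0 \<rho>" and w: "norm w < \<rho>"
  shows "ennreal ((norm (f w))\<^sup>2) \<le> ennreal ((\<rho> + norm w) / (\<rho> - norm w)) * circle_mean_square f \<rho>"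
proof -
  have "0 < (1::real)" by simp
  from circle_mean_square_comp_le[OF f _ this, of "\<lambda>_. w"] w
  have "circle_mean_square (f \<circ> (\<lambda>_. w)) 1 \<le> ennreal ((\<rho> + norm w) / (\<rho> - norm w)) * circle_mean_square f \<rho>"
    by auto
  moreover have "circle_mean_square (f \<circ> (\<lambda>_. w)) 1 = ennreal ((norm (f w))\<^sup>2)"
    by (simp add: circle_mean_square_def nn_integral_cmult)
  ultimately show ?thesis by simp
qed

section \<open>Compact subsets of the disc, and measurability of functions given only on the
  disc\<close>

lemma compact_subset_unit_ballE:
  fixes K :: "complex set"
  assumes "compact K" "K \<subseteq> ball 0 1"
  obtains a where "0 \<le> a" "a < 1" "\<And>z. z \<in> K \<Longrightarrow> norm z \<le> a"
proof (cases "K = {}")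
  case True
  then show ?thesis using that[of 0] by auto
next
  case False
  then obtain x where "x \<in> K" "\<And>z. z \<in> K \<Longrightarrow> norm z \<le> norm x"
    using continuous_attains_sup[OF assms(1), of norm] by (auto intro!: continuous_intros)
  then show ?thesis
    using that[of "norm x"] assms(2) by auto
qed

text \<open>A function holomorphic on the disc is arbitrary outside it. Cutting it off there gives a
  Borel function on the whole plane, as Tonelli's theorem requires.\<close>

definition disc_ext :: "(complex \<Rightarrow> complex) \<Rightarrow> complex \<Rightarrow> complex" where
  "disc_ext f z = (if z \<in> ball 0 1 then f z else 0)"

lemma measurable_disc_ext:
  "continuous_on (ball 0 1) f \<Longrightarrow> disc_ext f \<in> borel_measurable borel"
  unfolding disc_ext_def by (intro borel_measurable_continuous_on_if) auto

lemma measurable_circle_mean_square: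
  assumes [measurable]: "f \<in> borel_measurable borel"
  shows "circle_mean_square f \<in> borel_measurable borel"
  unfolding circle_mean_square_def by measurable

lemma circle_mean_square_disc_ext:
  "0 \<le> r \<Longrightarrow> r < 1 \<Longrightarrow> circle_mean_square (disc_ext f) r = circle_mean_square f r"
  by (simp add: circle_mean_square_def disc_ext_def norm_mult)

section \<open>Radial weights\<close>

text \<open>The weight vanishes off \<open>{0..<1}\<close>, so integrals against it can run over the
  whole line without indicators.\<close>

locale radial_weight =
  fixes s :: "real \<Rightarrow> real"
  assumes continuous_weight: "continuous_on {0..<1} s"
    and weight_pos: "\<And>t. t \<in> {0..<1} \<Longrightarrow> 0 < s t"
    and weight_eq_0: "\<And>t. t \<notin> {0..<1} \<Longrightarrow> s t = 0"
    and weight_integrable: "s integrable_on {0..1}"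
begin

lemma weight_nonneg: "0 \<le> s t"
  using weight_pos[of t] weight_eq_0[of t] by (cases "t \<in> {0..<1}") auto

lemma measurable_weight [measurable]: "s \<in> borel_measurable borel"
proof -
  have "(\<lambda>t. if t \<in> {0..<1} then s t else 0) \<in> borel_measurable borel"
    by (intro borel_measurable_continuous_on_if continuous_weight) auto
  also have "(\<lambda>t. if t \<in> {0..<1} then s t else 0) = s"
    using weight_eq_0 by fastforce
  finally show ?thesis .
qed

lemma weight_mult_integrable:
  assumes "continuous_on {0..1} h" "0 \<le> a" "b \<le> 1"
  shows "(\<lambda>t. h t * s t) integrable_on {a..b}"
proof -
  have "(\<lambda>t. h t * s t) absolutely_integrable_on {0..1}"
  proof (rule absolutely_integrable_bounded_measurable_product_real)
    show "h \<in> borel_measurable (lebesgue_on {0..1})"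
      by (rule continuous_imp_measurable_on_sets_lebesgue[OF assms(1)]) auto
    show "bounded (h ` {0..1})"
      by (intro compact_imp_bounded compact_continuous_image assms) auto
    show "s absolutely_integrable_on {0..1}"
      using weight_integrable weight_nonneg by (intro nonnegative_absolutely_integrable_1) auto
  qed auto
  then have "(\<lambda>t. h t * s t) integrable_on {0..1}"
    by (rule set_lebesgue_integral_eq_integral(1))
  then show ?thesis
    by (rule integrable_on_subinterval) (use assms in auto)
qed

section \<open>The tail integral as a decreasing change of variable\<close>

definition tail :: "real \<Rightarrow> real" where
  "tail x = integral {x..1} (\<lambda>t. t * s t)"

lemma tail_1 [simp]: "tail 1 = 0"
  by (simp add: tail_def)

lemma tail_split:
  assumes "0 \<le> x" "x \<le> y" "y \<le> 1"
  shows "tail x = integral {x..y} (\<lambda>t. t * s t) + tail y"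
  unfolding tail_def using assms
  by (intro Henstock_Kurzweil_Integration.integral_combine[symmetric] weight_mult_integrable) (auto intro!: continuous_intros)

lemma tail_antimono:
  assumes "0 \<le> x" "x \<le> y" "y \<le> 1"
  shows "tail y \<le> tail x"
proof -
  have "0 \<le> integral {x..y} (\<lambda>t. t * s t)"
    using assms by (intro Henstock_Kurzweil_Integration.integral_nonneg weight_mult_integrable) (auto intro!: continuous_intros mult_nonneg_nonneg weight_nonneg)
  then show ?thesis
    using tail_split[OF assms] by simp
qed

lemma tail_strict_antimono:
  assumes "0 \<le> x" "x < y" "y \<le> 1"
  shows "tail y < tail x"
proof -
  \<comment> \<open>\<open>y\<close> may be 1, where the weight need not be continuous. Up to the
    midpoint the integrand is continuous, and that part already gives strictness.\<close>
  define m where "m = (x + y) / 2"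
  have m: "x < m" "m < y" using assms by (auto simp: m_def)
  have "integral {x..m} (\<lambda>t. 0) < integral {x..m} (\<lambda>t. t * s t)"
  proof (rule integral_less_real)
    show "continuous_on {x..m} (\<lambda>t. t * s t)"
      using m assms by (intro continuous_intros continuous_on_subset[OF continuous_weight]) auto
    show "0 < t * s t" if "t \<in> {x<..<m}" for t
      using that m assms weight_pos[of t] by auto
  qed (use m in auto)
  moreover have "tail y \<le> tail m"
    using m assms by (intro tail_antimono) auto
  ultimately show ?thesis
    using tail_split[of x m] m assms by simp
qed

lemma tail_less_iff:
  assumes "x \<in> {0..1}" "y \<in> {0..1}"
  shows "tail x < tail y \<longleftrightarrow> y < x"
  using assms tail_strict_antimono[of x y] tail_strict_antimono[of y x] by (cases x y rule: linorder_cases) auto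

lemma tail_pos: "x \<in> {0..<1} \<Longrightarrow> 0 < tail x"
  using tail_strict_antimono[of x 1] by simp

lemma continuous_on_tail: "continuous_on {0..1} tail"
  unfolding tail_def
  by (intro indefinite_integral_continuous_1' weight_mult_integrable) (auto intro!: continuous_intros)

lemma tail_tendsto_0: "(tail \<longlongrightarrow> 0) (at_left 1)"
  using continuous_on_tail[unfolded continuous_on_def, rule_format, of 1]
  by (simp add: at_within_Icc_at_left)

lemma tail_image: "tail ` {0..1} = {0..tail 0}"
proof (intro equalityI subsetI)
  fix u assume "u \<in> {0..tail 0}"
  then obtain x where "0 \<le> x" "x \<le> 1" "tail x = u"
    using IVT2'[of tail 1 u 0, OF _ _ _ continuous_on_tail] by auto
  then show "u \<in> tail ` {0..1}" by auto
qed (use tail_antimono[of 0] tail_antimono[of _ 1] in auto)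

text \<open>The image of the measure \<open>r * s r\<close> under \<open>tail\<close> is Lebesgue
  measure on \<open>{0<..<tail 0}\<close>. Again half-lines suffice: for \<open>u\<close> in the
  range, the radii with \<open>u < tail r\<close> are those below the \<open>y\<close> with
  \<open>tail y = u\<close>, and their mass is \<open>tail 0 - tail y\<close>.\<close>

lemma nn_integral_tail_substitution:
  fixes g :: "real \<Rightarrow> ennreal"
  assumes [measurable]: "g \<in> borel_measurable borel"
  shows "(\<integral>\<^sup>+ r. ennreal (r * s r) * g (tail r) \<partial>lborel) = (\<integral>\<^sup>+ u. g u * indicator {0<..<tail 0} u \<partial>lborel)"
proof -
  \<comment> \<open>Clamping the argument gives a continuous function on the whole line, hence a
    Borel map; where the clamping matters, the weight is 0.\<close>
  define T where "T = (\<lambda>r. tail (max 0 (min 1 r)))"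
  have "continuous_on UNIV T"
    unfolding T_def by (rule continuous_on_compose2[OF continuous_on_tail]) (auto intro!: continuous_intros)
  then have [measurable]: "T \<in> borel_measurable borel"
    by (rule borel_measurable_continuous_onI)
  have T: "T r = tail r" if "r \<in> {0..1}" for r
    using that by (simp add: T_def max_absorb2 min_absorb2)
  define M where "M = distr (density lborel (\<lambda>r. ennreal (r * s r))) borel T"
  define N where "N = density lborel (indicator {0<..<tail 0})"
  have M: "emeasure M {u<..} = (\<integral>\<^sup>+ r. ennreal (r * s r) * indicator {u<..} (T r) \<partial>lborel)" for u
  proof -
    have "emeasure M {u<..} = (\<integral>\<^sup>+ x. indicator {u<..} x \<partial>M)"
      unfolding M_def by simp
    also have "\<dots> = (\<integral>\<^sup>+ r. ennreal (r * s r) * indicator {u<..} (T r) \<partial>lborel)"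
      unfolding M_def by (subst nn_integral_distr) (auto simp: nn_integral_density)
    finally show ?thesis .
  qed
  have N: "emeasure N {u<..} = emeasure lborel {max u 0<..<tail 0}" for u
  proof -
    have "emeasure N {u<..} = (\<integral>\<^sup>+ x. indicator {max u 0<..<tail 0} x \<partial>lborel)"
      unfolding N_def
      by (subst emeasure_density) (auto intro!: nn_integral_cong split: split_indicator simp del: nn_integral_indicator)
    then show ?thesis by simp
  qed
  have MN1: "emeasure M {u<..} = ennreal (tail 0 - max u 0)" if u: "u < tail 0" for u
  proof -
    have "max u 0 \<in> {0..tail 0}"
      using u tail_pos[of 0] by auto
    then obtain y where y: "y \<in> {0..1}" "tail y = max u 0"
      unfolding tail_image[symmetric] by auto
    have "emeasure M {u<..} = (\<integral>\<^sup>+ r. ennreal (r * s r) * indicator {0..y} r \<partial>lborel)"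
      unfolding M
    proof (rule nn_integral_cong_AE)
      show "AE r in lborel. ennreal (r * s r) * indicator {u<..} (T r) = ennreal (r * s r) * indicator {0..y} r"
        using AE_lborel_singleton[of y]
      proof eventually_elim
        case (elim r)
        show ?case
        proof (cases "r \<in> {0..<1}")
          case True
          then have "u < tail r \<longleftrightarrow> tail y < tail r"
            using tail_pos[of r] y(2) by auto
          also have "\<dots> \<longleftrightarrow> r < y"
            using True y(1) by (intro tail_less_iff) auto
          finally show ?thesis
            using True elim by (auto simp: T split: split_indicator)
        qed (simp add: weight_eq_0)
      qed
    qed
    also have "\<dots> = ennreal (integral {0..y} (\<lambda>t. t * s t))"
      using y(1) by (intro nn_integral_has_integral_lebesgue' integrable_integral weight_mult_integrable)
        (auto intro!: continuous_intros mult_nonneg_nonneg weight_nonneg)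
    also have "integral {0..y} (\<lambda>t. t * s t) = tail 0 - max u 0"
      using tail_split[of 0 y] y by simp
    finally show ?thesis .
  qed
  have MN2: "emeasure M {u<..} = 0" if u: "tail 0 \<le> u" for u
  proof -
    have "T r \<le> u" for r
      using u tail_antimono[of 0 "max 0 (min 1 r)"] by (auto simp: T_def)
    then have "indicator {u<..} (T r) = (0::ennreal)" for r
      by (simp add: not_less)
    then show ?thesis
      unfolding M by simp
  qed
  have "M = N"
  proof (rule measure_eqI_lessThan)
    fix u :: real
    show "emeasure M {u<..} < \<infinity>"
      by (cases "u < tail 0") (auto simp: MN1 MN2)
    show "emeasure M {u<..} = emeasure N {u<..}"
      using tail_pos[of 0] by (cases "u < tail 0") (auto simp: MN1 MN2 N)
  qed (auto simp: M_def N_def)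
  have "(\<integral>\<^sup>+ r. ennreal (r * s r) * g (tail r) \<partial>lborel) = (\<integral>\<^sup>+ r. ennreal (r * s r) * g (T r) \<partial>lborel)"
  proof (rule nn_integral_cong)
    show "ennreal (r * s r) * g (tail r) = ennreal (r * s r) * g (T r)" for r
      by (cases "r \<in> {0..1}") (auto simp: T weight_eq_0)
  qed
  also have "\<dots> = integral\<^sup>N M g"
    unfolding M_def by (subst nn_integral_distr) (auto simp: nn_integral_density)
  also have "\<dots> = (\<integral>\<^sup>+ u. g u * indicator {0<..<tail 0} u \<partial>lborel)"
    unfolding \<open>M = N\<close> N_def by (simp add: nn_integral_density mult.commute)
  finally show ?thesis .
qed

text \<open>The default 0 off the range of \<open>tail\<close> makes the inverse a Borel function on
  the whole line.\<close>

definition tail_inv :: "real \<Rightarrow> real" where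
  "tail_inv u = (if u \<in> tail ` {0..1} then inv_into {0..1} tail u else 0)"

lemma inj_on_tail: "inj_on tail {0..1}"
  by (rule inj_onI) (metis tail_less_iff less_irrefl linorder_less_linear)

lemma tail_inv_tail: "r \<in> {0..1} \<Longrightarrow> tail_inv (tail r) = r"
  by (simp add: tail_inv_def inj_on_tail)

lemma tail_tail_inv:
  assumes "u \<in> {0..tail 0}"
  shows "tail_inv u \<in> {0..1}" "tail (tail_inv u) = u"
  using assms unfolding tail_image[symmetric] by (auto simp: tail_inv_tail)

lemma measurable_tail_inv [measurable]: "tail_inv \<in> borel_measurable borel"
  unfolding tail_inv_def
proof (rule borel_measurable_continuous_on_if)
  show "continuous_on (tail ` {0..1}) (inv_into {0..1} tail)"
    by (rule continuous_on_inv[OF continuous_on_tail]) (auto simp: inj_on_tail)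
qed (auto simp: tail_image)

text \<open>In the variable \<open>u = tail r\<close> the measure is Lebesgue measure and the change
  of radius is division by \<epsilon>, so substituting \<open>u = \<epsilon> * v\<close> yields the
  factor \<epsilon>. The condition on \<open>r1\<close> keeps \<open>u / \<epsilon>\<close> in the
  range of \<open>tail\<close>; the result is only an inequality because \<open>v\<close> need not
  fill that range.\<close>

lemma nn_integral_tail_scaling:
  fixes N :: "real \<Rightarrow> ennreal"
  assumes [measurable]: "N \<in> borel_measurable borel"
    and \<epsilon>: "0 < \<epsilon>" and r1: "r1 \<in> {0..1}" "tail r1 \<le> \<epsilon> * tail 0"
  shows "(\<integral>\<^sup>+ r. ennreal (r * s r) * (N (tail_inv (tail r / \<epsilon>)) * indicator {r1<..} r) \<partial>lborel)
    \<le> ennreal \<epsilon> * (\<integral>\<^sup>+ r. ennreal (r * s r) * N r \<partial>lborel)"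
proof -
  define g where "g = (\<lambda>u. N (tail_inv (u / \<epsilon>)) * indicator {..<tail r1} u)"
  have [measurable]: "g \<in> borel_measurable borel"
    unfolding g_def by measurable
  have "(\<integral>\<^sup>+ r. ennreal (r * s r) * (N (tail_inv (tail r / \<epsilon>)) * indicator {r1<..} r) \<partial>lborel)
      = (\<integral>\<^sup>+ r. ennreal (r * s r) * g (tail r) \<partial>lborel)"
  proof (rule nn_integral_cong)
    show "ennreal (r * s r) * (N (tail_inv (tail r / \<epsilon>)) * indicator {r1<..} r) = ennreal (r * s r) * g (tail r)" for r
      using r1 by (cases "r \<in> {0..1}") (auto simp: weight_eq_0 g_def tail_less_iff split: split_indicator)
  qed
  also have "\<dots> = (\<integral>\<^sup>+ u. g u * indicator {0<..<tail 0} u \<partial>lborel)"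
    by (rule nn_integral_tail_substitution) measurable
  also have "\<dots> = ennreal \<epsilon> * (\<integral>\<^sup>+ v. g (\<epsilon> * v) * indicator {0<..<tail 0} (\<epsilon> * v) \<partial>lborel)"
    using \<epsilon> by (subst nn_integral_real_affine[where c = \<epsilon> and t = 0]) auto
  also have "\<dots> \<le> ennreal \<epsilon> * (\<integral>\<^sup>+ v. N (tail_inv v) * indicator {0<..<tail 0} v \<partial>lborel)"
  proof (intro mult_left_mono nn_integral_mono)
    fix v :: real
    have "v < tail 0" if "\<epsilon> * v < tail r1"
    proof -
      have "\<epsilon> * v < \<epsilon> * tail 0" using that r1(2) by linarith
      then show ?thesis using \<epsilon> by simp
    qed
    then show "g (\<epsilon> * v) * indicator {0<..<tail 0} (\<epsilon> * v) \<le> N (tail_inv v) * indicator {0<..<tail 0} v"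
      using \<epsilon> by (auto simp: g_def zero_less_mult_iff split: split_indicator)
  qed auto
  also have "(\<integral>\<^sup>+ v. N (tail_inv v) * indicator {0<..<tail 0} v \<partial>lborel)
      = (\<integral>\<^sup>+ r. ennreal (r * s r) * N (tail_inv (tail r)) \<partial>lborel)"
    by (rule nn_integral_tail_substitution[symmetric]) measurable
  also have "\<dots> = (\<integral>\<^sup>+ r. ennreal (r * s r) * N r \<partial>lborel)"
  proof (rule nn_integral_cong)
    show "ennreal (r * s r) * N (tail_inv (tail r)) = ennreal (r * s r) * N r" for r
      by (cases "r \<in> {0..1}") (auto simp: weight_eq_0 tail_inv_tail)
  qed
  finally show ?thesis .
qed

subsection \<open>Composition with a self-map of the disc\<close>

definition annulus_integral :: "real \<Rightarrow> (complex \<Rightarrow> complex) \<Rightarrow> ennreal" where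
  "annulus_integral a f =
     (\<integral>\<^sup>+ z. ennreal ((norm (f z))\<^sup>2 * s (norm z) / pi) * indicator (ball 0 1 - cball 0 a) z \<partial>lborel)"

text \<open>\<open>cball 0 (-1)\<close> is empty, so the polar formula for annuli covers the full
  norm as well.\<close>

lemma A2_integral_eq_annulus: "A2_integral s f = annulus_integral (-1) f"
  by (simp add: A2_integral_def annulus_integral_def)

lemma measurable_integrand:
  fixes f :: "complex \<Rightarrow> complex"
  assumes "continuous_on (ball 0 1) f" "A \<in> sets borel"
  shows "(\<lambda>z. ennreal ((norm (f z))\<^sup>2 * s (norm z) / pi) * indicator (ball 0 1 - A) z) \<in> borel_measurable borel"
proof -
  have [measurable]: "disc_ext f \<in> borel_measurable borel" "ball (0::complex) 1 \<in> sets borel" "A \<in> sets borel"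
    using assms measurable_disc_ext by auto
  have "(\<lambda>z. ennreal ((norm (disc_ext f z))\<^sup>2 * s (norm z) / pi) * indicator (ball 0 1 - A) z) \<in> borel_measurable borel"
    by measurable
  also have "(\<lambda>z. ennreal ((norm (disc_ext f z))\<^sup>2 * s (norm z) / pi) * indicator (ball 0 1 - A) z)
      = (\<lambda>z. ennreal ((norm (f z))\<^sup>2 * s (norm z) / pi) * indicator (ball 0 1 - A) z)"
    by (auto simp: disc_ext_def fun_eq_iff split: split_indicator)
  finally show ?thesis .
qed

text \<open>The \<pi> from the normalised area cancels against the Jacobian
  \<open>2 * pi * r\<close>. What is left is twice the measure \<open>r * s r\<close>, the one that
  \<open>tail\<close> integrates.\<close>

lemma annulus_integral_polar:
  assumes "continuous_on (ball 0 1) f"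
  shows "annulus_integral a f = 2 * (\<integral>\<^sup>+ r. ennreal (r * s r)
      * (circle_mean_square (disc_ext f) r * indicator {a<..} r) \<partial>lborel)"
proof -
  have [measurable]: "disc_ext f \<in> borel_measurable borel"
    using assms by (rule measurable_disc_ext)
  note measurable_circle_mean_square[of "disc_ext f", measurable]
  define h where "h = (\<lambda>z. ennreal ((norm (disc_ext f z))\<^sup>2 * s (norm z) / pi) * indicator {a<..} (norm z))"
  have [measurable]: "h \<in> borel_measurable borel"
    unfolding h_def by measurable
  have "annulus_integral a f = (\<integral>\<^sup>+ z. h z * indicator (ball 0 1) z \<partial>lborel)"
    unfolding annulus_integral_def h_def
    by (intro nn_integral_cong) (auto simp: disc_ext_def split: split_indicator)
  also have "\<dots> = (\<integral>\<^sup>+ r. ennreal (2 * pi * r)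
      * (\<integral>\<^sup>+ t. h (of_real r * cis (2 * pi * t)) * indicator {0..1} t \<partial>lborel) * indicator {0<..<1} r \<partial>lborel)"
    by (rule nn_integral_unit_ball_polar) measurable
  also have "\<dots> = (\<integral>\<^sup>+ r. 2 * (ennreal (r * s r)
      * (circle_mean_square (disc_ext f) r * indicator {a<..} r)) \<partial>lborel)"
  proof (rule nn_integral_cong)
    fix r :: real
    show "ennreal (2 * pi * r) * (\<integral>\<^sup>+ t. h (of_real r * cis (2 * pi * t)) * indicator {0..1} t \<partial>lborel)
        * indicator {0<..<1} r = 2 * (ennreal (r * s r) * (circle_mean_square (disc_ext f) r * indicator {a<..} r))"
    proof (cases "r \<in> {0<..<1}")
      case True
      have "(\<integral>\<^sup>+ t. h (of_real r * cis (2 * pi * t)) * indicator {0..1} t \<partial>lborel)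
          = (\<integral>\<^sup>+ t. (ennreal (s r / pi) * indicator {a<..} r)
              * (ennreal ((norm (disc_ext f (of_real r * cis (2 * pi * t))))\<^sup>2) * indicator {0..1} t) \<partial>lborel)"
        unfolding h_def using True weight_nonneg[of r]
        by (intro nn_integral_cong) (auto simp: norm_mult ennreal_mult''[symmetric] mult.commute split: split_indicator)
      also have "\<dots> = (ennreal (s r / pi) * indicator {a<..} r) * circle_mean_square (disc_ext f) r"
        unfolding circle_mean_square_def by (rule nn_integral_cmult) measurable
      finally have "ennreal (2 * pi * r) * (\<integral>\<^sup>+ t. h (of_real r * cis (2 * pi * t)) * indicator {0..1} t \<partial>lborel)
          = (ennreal (2 * pi * r) * ennreal (s r / pi)) * (circle_mean_square (disc_ext f) r * indicator {a<..} r)"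
        by (simp add: mult_ac)
      also have "ennreal (2 * pi * r) * ennreal (s r / pi) = 2 * ennreal (r * s r)"
      proof -
        have "ennreal (2 * pi * r) * ennreal (s r / pi) = ennreal (2 * (r * s r))"
          using True weight_nonneg[of r] by (simp add: ennreal_mult''[symmetric])
        also have "\<dots> = 2 * ennreal (r * s r)"
          using True weight_nonneg[of r] by (simp add: ennreal_mult)
        finally show ?thesis .
      qed
      finally show ?thesis
        using True by (simp add: mult.assoc)
    next
      case False
      then have "r * s r = 0"
        using weight_eq_0[of r] by (cases "r = 0") auto
      then have "ennreal (r * s r) = 0"
        by (metis ennreal_0)
      then show ?thesis
        using False by auto
    qed
  qed
  also have "\<dots> = 2 * (\<integral>\<^sup>+ r. ennreal (r * s r)
      * (circle_mean_square (disc_ext f) r * indicator {a<..} r) \<partial>lborel)"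
    by (rule nn_integral_cmult) measurable
  finally show ?thesis .
qed

lemma A2_integral_polar:
  assumes "continuous_on (ball 0 1) f"
  shows "A2_integral s f = 2 * (\<integral>\<^sup>+ r. ennreal (r * s r) * circle_mean_square (disc_ext f) r \<partial>lborel)"
proof -
  have "ennreal (r * s r) * (circle_mean_square (disc_ext f) r * indicator {-1<..} r)
      = ennreal (r * s r) * circle_mean_square (disc_ext f) r" for r
    using weight_eq_0[of r] by (cases "r \<in> {0..<1}") auto
  then show ?thesis
    unfolding A2_integral_eq_annulus annulus_integral_polar[OF assms] by simp
qed

section \<open>Pointwise bounds, and splitting the norm at a radius\<close>

lemma nn_integral_weight_tail:
  assumes "b \<in> {0..1}"
  shows "(\<integral>\<^sup>+ r. ennreal (r * s r) * indicator {b<..} r \<partial>lborel) = ennreal (tail b)"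
proof -
  have "(\<integral>\<^sup>+ r. ennreal (r * s r) * indicator {b<..} r \<partial>lborel)
      = (\<integral>\<^sup>+ r. ennreal (r * s r) * indicator {..<tail b} (tail r) \<partial>lborel)"
  proof (rule nn_integral_cong)
    show "ennreal (r * s r) * indicator {b<..} r = ennreal (r * s r) * indicator {..<tail b} (tail r)" for r
      using assms by (cases "r \<in> {0..1}") (auto simp: weight_eq_0 tail_less_iff split: split_indicator)
  qed
  also have "\<dots> = (\<integral>\<^sup>+ u. indicator {..<tail b} u * indicator {0<..<tail 0} u \<partial>lborel)"
    by (rule nn_integral_tail_substitution) measurable
  also have "\<dots> = (\<integral>\<^sup>+ u. indicator {0<..<tail b} u \<partial>lborel)"
    using tail_antimono[of 0 b] assms by (intro nn_integral_cong) (auto split: split_indicator)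
  also have "\<dots> = ennreal (tail b)"
    using tail_antimono[of b 1] assms by simp
  finally show ?thesis .
qed

lemma A2_integral_one: "A2_integral s (\<lambda>_. 1) = ennreal (2 * tail 0)"
proof -
  have "circle_mean_square (disc_ext (\<lambda>_. 1)) r = 1" if "r \<in> {0..<1}" for r
    using that by (simp add: circle_mean_square_disc_ext) (simp add: circle_mean_square_def)
  then have "ennreal (r * s r) * circle_mean_square (disc_ext (\<lambda>_. 1)) r = ennreal (r * s r) * indicator {0<..} r" for r
    by (cases "r \<in> {0..<1}") (auto simp: weight_eq_0 split: split_indicator)
  then have "A2_integral s (\<lambda>_. 1) = 2 * ennreal (tail 0)"
    by (simp add: A2_integral_polar nn_integral_weight_tail)
  then show ?thesis
    using tail_pos[of 0] by (simp add: ennreal_mult)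
qed

text \<open>The bound on a single circle is integrated over the radii beyond
  \<open>b = (1 + a) / 2\<close>, whose mass is \<open>tail b\<close>. They keep distance at least
  \<open>b - a = (1 - a) / 2\<close> from \<open>norm w\<close>, so the Harnack constant is at most
  \<open>2 / (b - a)\<close>. The bound feeds Montel's theorem.\<close>

lemma norm_square_le_A2_integral:
  assumes f: "f holomorphic_on ball 0 1" and w: "norm w \<le> a" and a: "0 \<le> a" "a < 1"
  shows "ennreal ((1 - a) / 2 * tail ((1 + a) / 2) * (norm (f w))\<^sup>2) \<le> A2_integral s f"
proof -
  define b where "b = (1 + a) / 2"
  have b: "a < b" "b < 1" using a by (auto simp: b_def)
  have cf: "continuous_on (ball 0 1) f"
    using f by (rule holomorphic_on_imp_continuous_on)
  have [measurable]: "circle_mean_square (disc_ext f) \<in> borel_measurable borel"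
    using cf by (intro measurable_circle_mean_square measurable_disc_ext)
  have "ennreal (tail b) * ennreal ((norm (f w))\<^sup>2)
      = (\<integral>\<^sup>+ r. ennreal (r * s r) * indicator {b<..} r \<partial>lborel) * ennreal ((norm (f w))\<^sup>2)"
    using a b by (simp add: nn_integral_weight_tail)
  also have "\<dots> = (\<integral>\<^sup>+ r. ennreal (r * s r) * indicator {b<..} r * ennreal ((norm (f w))\<^sup>2) \<partial>lborel)"
    by (rule nn_integral_multc[symmetric]) measurable
  also have "\<dots> \<le> (\<integral>\<^sup>+ r. ennreal (2 / (b - a)) * (ennreal (r * s r) * circle_mean_square (disc_ext f) r) \<partial>lborel)"
  proof (rule nn_integral_mono)
    fix r :: real
    show "ennreal (r * s r) * indicator {b<..} r * ennreal ((norm (f w))\<^sup>2)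
        \<le> ennreal (2 / (b - a)) * (ennreal (r * s r) * circle_mean_square (disc_ext f) r)"
    proof (cases "b < r \<and> r < 1")
      case True
      have "ennreal ((norm (f w))\<^sup>2) \<le> ennreal ((r + norm w) / (r - norm w)) * circle_mean_square f r"
        using True w b by (intro norm_square_le_circle_mean_square holomorphic_on_subset[OF f]) auto
      also have "\<dots> \<le> ennreal (2 / (b - a)) * circle_mean_square f r"
        using True w b by (intro mult_right_mono ennreal_leI frac_le) auto
      also have "circle_mean_square f r = circle_mean_square (disc_ext f) r"
        using True a b by (simp add: circle_mean_square_disc_ext)
      finally have "ennreal (r * s r) * ennreal ((norm (f w))\<^sup>2)
          \<le> ennreal (r * s r) * (ennreal (2 / (b - a)) * circle_mean_square (disc_ext f) r)"
        by (rule mult_left_mono) auto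
      then show ?thesis
        using True by (simp add: mult_ac)
    next
      case False
      then have "ennreal (r * s r) * indicator {b<..} r = 0"
        by (auto simp: weight_eq_0)
      then show ?thesis by (simp del: mult_eq_0_iff)
    qed
  qed
  also have "\<dots> = ennreal (2 / (b - a)) * (\<integral>\<^sup>+ r. ennreal (r * s r) * circle_mean_square (disc_ext f) r \<partial>lborel)"
    by (rule nn_integral_cmult) measurable
  also have "ennreal (2 / (b - a)) = ennreal (1 / (b - a)) * 2"
    using b by (metis ennreal_mult'' ennreal_numeral mult.commute mult.right_neutral times_divide_eq_right zero_le_numeral)
  finally have "ennreal (tail b) * ennreal ((norm (f w))\<^sup>2) \<le> ennreal (1 / (b - a)) * A2_integral s f"
    by (simp add: A2_integral_polar[OF cf] mult.assoc)
  then have "ennreal (b - a) * (ennreal (tail b) * ennreal ((norm (f w))\<^sup>2))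
      \<le> ennreal (b - a) * (ennreal (1 / (b - a)) * A2_integral s f)"
    by (rule mult_left_mono) auto
  also have "\<dots> = (ennreal (b - a) * ennreal (1 / (b - a))) * A2_integral s f"
    by (simp add: mult.assoc)
  also have "ennreal (b - a) * ennreal (1 / (b - a)) = 1"
    using b by (simp add: ennreal_mult''[symmetric])
  finally have "ennreal ((b - a) * tail b * (norm (f w))\<^sup>2) \<le> A2_integral s f"
    using b a tail_pos[of b] by (simp add: ennreal_mult mult.assoc)
  moreover have "b - a = (1 - a) / 2"
    by (simp add: b_def field_simps)
  ultimately show ?thesis
    by (simp add: b_def)
qed

text \<open>The inner disc is paid for by the supremum \<open>c\<close> and the mass
  \<open>2 * tail 0\<close> of the whole disc; only the annulus needs an estimate in the
  mean.\<close>

lemma A2_integral_le_annulus: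
  assumes g: "continuous_on (ball 0 1) g" and c: "\<And>z. z \<in> ball 0 1 \<Longrightarrow> norm z \<le> a \<Longrightarrow> norm (g z) \<le> c"
  shows "A2_integral s g \<le> ennreal (c\<^sup>2 * (2 * tail 0)) + annulus_integral a g"
proof -
  have m1: "(\<lambda>z::complex. ennreal ((norm (1::complex))\<^sup>2 * s (norm z) / pi) * indicator (ball 0 1) z) \<in> borel_measurable borel"
    using measurable_integrand[of "\<lambda>_. 1" "{}"] by simp
  have "A2_integral s g
      \<le> (\<integral>\<^sup>+ z. ennreal (c\<^sup>2) * (ennreal ((norm (1::complex))\<^sup>2 * s (norm z) / pi) * indicator (ball 0 1) z)
          + ennreal ((norm (g z))\<^sup>2 * s (norm z) / pi) * indicator (ball 0 1 - cball 0 a) z \<partial>lborel)"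
    unfolding A2_integral_def
  proof (rule nn_integral_mono)
    fix z :: complex
    have "(norm (g z))\<^sup>2 * s (norm z) / pi \<le> c\<^sup>2 * (s (norm z) / pi)" if "z \<in> ball 0 1" "norm z \<le> a"
    proof -
      have "(norm (g z))\<^sup>2 \<le> c\<^sup>2"
        using c[OF that] by (intro power_mono) auto
      then have "(norm (g z))\<^sup>2 * (s (norm z) / pi) \<le> c\<^sup>2 * (s (norm z) / pi)"
        using weight_nonneg by (intro mult_right_mono) auto
      then show ?thesis by simp
    qed
    then show "ennreal ((norm (g z))\<^sup>2 * s (norm z) / pi) * indicator (ball 0 1) z
        \<le> ennreal (c\<^sup>2) * (ennreal ((norm (1::complex))\<^sup>2 * s (norm z) / pi) * indicator (ball 0 1) z)
          + ennreal ((norm (g z))\<^sup>2 * s (norm z) / pi) * indicator (ball 0 1 - cball 0 a) z"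
      using weight_nonneg[of "norm z"]
      by (auto simp: ennreal_mult[symmetric] intro!: ennreal_leI split: split_indicator)
  qed
  also have "\<dots> = ennreal (c\<^sup>2) * A2_integral s (\<lambda>_. 1) + annulus_integral a g"
    unfolding A2_integral_def annulus_integral_def
    using m1 measurable_integrand[OF g, of "cball 0 a"]
    by (subst nn_integral_add) (auto simp: nn_integral_cmult)
  also have "\<dots> = ennreal (c\<^sup>2 * (2 * tail 0)) + annulus_integral a g"
    using tail_pos[of 0] by (simp add: A2_integral_one ennreal_mult)
  finally show ?thesis .
qed

text \<open>\<open>le\<close> places the image of the disc of radius \<open>r\<close> inside the
  disc of radius \<open>\<rho> = tail_inv (tail r / \<epsilon>)\<close>, as subordination requires.
  \<open>le0\<close> keeps \<rho> beyond the midpoint of \<open>norm (\<phi> 0)\<close> and 1, which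
  bounds the subordination factor uniformly in \<open>r\<close>.\<close>

lemma annulus_integral_comp_le:
  assumes f: "f holomorphic_on ball 0 1"
    and \<phi>: "\<phi> holomorphic_on ball 0 1" "\<phi> ` ball 0 1 \<subseteq> ball 0 1"
    and \<epsilon>: "0 < \<epsilon>" and r1: "r1 \<in> {0..<1}"
    and le: "\<And>r z. r1 < r \<Longrightarrow> r < 1 \<Longrightarrow> z \<in> cball 0 r \<Longrightarrow> tail r < \<epsilon> * tail (norm (\<phi> z))"
    and le0: "tail r1 \<le> \<epsilon> * tail ((1 + norm (\<phi> 0)) / 2)"
  shows "annulus_integral r1 (f \<circ> \<phi>)
    \<le> ennreal (2 * (1 + norm (\<phi> 0)) / (1 - norm (\<phi> 0)) * \<epsilon>) * A2_integral s f"
proof -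
  define p where "p = norm (\<phi> 0)"
  define K where "K = 2 * (1 + p) / (1 - p)"
  have p: "0 \<le> p" "p < 1"
    using \<phi>(2) by (auto simp: p_def image_subset_iff)
  then have K: "0 \<le> K" by (simp add: K_def)
  have cf: "continuous_on (ball 0 1) f" and c\<phi>: "continuous_on (ball 0 1) \<phi>"
    using f \<phi>(1) by (auto intro: holomorphic_on_imp_continuous_on)
  have cf\<phi>: "continuous_on (ball 0 1) (f \<circ> \<phi>)"
    using continuous_on_compose[OF c\<phi>] continuous_on_subset[OF cf \<phi>(2)] by blast
  let ?N = "circle_mean_square (disc_ext f)"
  have [measurable]: "?N \<in> borel_measurable borel"
    using cf by (intro measurable_circle_mean_square measurable_disc_ext)
  have pt: "circle_mean_square (f \<circ> \<phi>) r \<le> ennreal K * ?N (tail_inv (tail r / \<epsilon>))" if r: "r1 < r" "r < 1" for r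
  proof -
    define \<rho> where "\<rho> = tail_inv (tail r / \<epsilon>)"
    have \<phi>1: "norm (\<phi> z) \<in> {0..1}" if "z \<in> cball 0 r" for z
    proof -
      have "z \<in> ball 0 1" using that r by auto
      then have "\<phi> z \<in> ball 0 1" using \<phi>(2) by blast
      then show ?thesis by auto
    qed
    \<comment> \<open>The point \<open>z = 0\<close> alone shows that
      \<open>tail r / \<epsilon>\<close> is a value of \<open>tail\<close>, so that \<rho> is a true
      preimage and not the default of \<open>tail_inv\<close>.\<close>
    have "tail r / \<epsilon> < tail p"
      using le[OF r, of 0] r r1 \<epsilon> by (simp add: p_def field_simps)
    also have "tail p \<le> tail 0"
      using p by (intro tail_antimono) auto
    finally have "tail r / \<epsilon> \<in> {0..tail 0}"
      using tail_pos[of r] r r1 \<epsilon> by auto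
    from tail_tail_inv[OF this] have \<rho>: "\<rho> \<in> {0..1}" and T\<rho>: "tail \<rho> = tail r / \<epsilon>"
      by (auto simp: \<rho>_def)
    have "tail 1 < tail \<rho>"
      using tail_pos[of r] r r1 \<epsilon> by (simp add: T\<rho>)
    then have \<rho>1: "\<rho> < 1"
      using \<rho> by (subst (asm) tail_less_iff) auto
    have "tail \<rho> < tail ((1 + p) / 2)"
    proof -
      have "tail r < tail r1"
        using r r1 by (intro tail_strict_antimono) auto
      also note le0
      finally show ?thesis
        using \<epsilon> by (simp add: T\<rho> p_def field_simps)
    qed
    then have \<rho>0: "(1 + p) / 2 < \<rho>"
      using \<rho> p by (subst (asm) tail_less_iff) auto
    have lt: "norm (\<phi> z) < \<rho>" if z: "z \<in> cball 0 r" for z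
    proof -
      have "tail \<rho> < tail (norm (\<phi> z))"
        using le[OF r z] \<epsilon> by (simp add: T\<rho> field_simps)
      then show ?thesis
        using \<rho> \<phi>1[OF z] by (subst (asm) tail_less_iff) auto
    qed
    have "circle_mean_square (f \<circ> \<phi>) r \<le> ennreal ((\<rho> + norm (\<phi> 0)) / (\<rho> - norm (\<phi> 0))) * circle_mean_square f \<rho>"
    proof (rule circle_mean_square_comp_le)
      show "f holomorphic_on cball 0 \<rho>"
        using \<rho>1 by (intro holomorphic_on_subset[OF f]) auto
      show "\<phi> holomorphic_on cball 0 r"
        using r by (intro holomorphic_on_subset[OF \<phi>(1)]) auto
    qed (use r r1 lt in auto)
    also have "\<dots> \<le> ennreal K * circle_mean_square f \<rho>"
    proof (intro mult_right_mono ennreal_leI)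
      have "(\<rho> + p) / (\<rho> - p) \<le> (1 + p) / ((1 - p) / 2)"
        using \<rho>0 \<rho>1 p by (intro frac_le) auto
      then show "(\<rho> + norm (\<phi> 0)) / (\<rho> - norm (\<phi> 0)) \<le> K"
        by (simp add: K_def p_def mult.commute)
    qed auto
    also have "circle_mean_square f \<rho> = ?N \<rho>"
      using \<rho> \<rho>1 by (simp add: circle_mean_square_disc_ext)
    finally show ?thesis
      unfolding \<rho>_def .
  qed
  have "annulus_integral r1 (f \<circ> \<phi>)
      = 2 * (\<integral>\<^sup>+ r. ennreal (r * s r) * (circle_mean_square (disc_ext (f \<circ> \<phi>)) r * indicator {r1<..} r) \<partial>lborel)"
    by (rule annulus_integral_polar[OF cf\<phi>])
  also have "\<dots> \<le> 2 * (\<integral>\<^sup>+ r. ennreal (r * s r)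
      * ((ennreal K * ?N (tail_inv (tail r / \<epsilon>))) * indicator {r1<..} r) \<partial>lborel)"
  proof (rule mult_left_mono[OF nn_integral_mono])
    fix r :: real
    show "ennreal (r * s r) * (circle_mean_square (disc_ext (f \<circ> \<phi>)) r * indicator {r1<..} r)
        \<le> ennreal (r * s r) * ((ennreal K * ?N (tail_inv (tail r / \<epsilon>))) * indicator {r1<..} r)"
    proof (cases "r1 < r \<and> r < 1")
      case True
      then have "ennreal (r * s r) * circle_mean_square (f \<circ> \<phi>) r
          \<le> ennreal (r * s r) * (ennreal K * ?N (tail_inv (tail r / \<epsilon>)))"
        by (intro mult_left_mono pt) auto
      then show ?thesis
        using True r1 by (simp add: circle_mean_square_disc_ext)
    next
      case False
      then show ?thesis
        by (cases "r < 1") (auto simp: weight_eq_0)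
    qed
  qed auto
  also have "\<dots> \<le> 2 * (ennreal \<epsilon> * (\<integral>\<^sup>+ r. ennreal (r * s r) * (ennreal K * ?N r) \<partial>lborel))"
  proof (rule mult_left_mono[OF nn_integral_tail_scaling])
    have "tail ((1 + p) / 2) \<le> tail 0"
      using p by (intro tail_antimono) auto
    then have "\<epsilon> * tail ((1 + p) / 2) \<le> \<epsilon> * tail 0"
      using \<epsilon> by simp
    then show "tail r1 \<le> \<epsilon> * tail 0"
      using le0 by (simp add: p_def)
  qed (use \<epsilon> r1 in auto)
  also have "(\<integral>\<^sup>+ r. ennreal (r * s r) * (ennreal K * ?N r) \<partial>lborel)
      = ennreal K * (\<integral>\<^sup>+ r. ennreal (r * s r) * ?N r \<partial>lborel)"
    by (subst nn_integral_cmult[symmetric]) (auto simp: mult_ac)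
  finally have "annulus_integral r1 (f \<circ> \<phi>) \<le> ennreal K * ennreal \<epsilon> * A2_integral s f"
    unfolding A2_integral_polar[OF cf] by (simp only: mult_ac)
  also have "ennreal K * ennreal \<epsilon> = ennreal (K * \<epsilon>)"
    using K \<epsilon> by (simp add: ennreal_mult)
  finally show ?thesis
    unfolding K_def p_def .
qed

text \<open>The constant \<open>K\<close> depends only on \<open>norm (\<phi> 0)\<close>, so it is
  absorbed by working with \<open>\<epsilon> / K\<close>. The radius \<open>a\<close> is chosen
  before \<open>f\<close>; compactness rests on this uniformity.\<close>

lemma annulus_integral_comp_small:
  assumes \<phi>: "\<phi> holomorphic_on ball 0 1" "\<phi> ` ball 0 1 \<subseteq> ball 0 1"
    and lim: "\<And>\<epsilon>. 0 < \<epsilon> \<Longrightarrow> \<forall>\<^sub>F r in at_left 1. \<forall>z\<in>cball 0 r. tail r < \<epsilon> * tail (norm (\<phi> z))"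
    and \<epsilon>: "0 < \<epsilon>"
  obtains a where "a \<in> {0..<1}"
    "\<And>f. f holomorphic_on ball 0 1 \<Longrightarrow> annulus_integral a (f \<circ> \<phi>) \<le> ennreal \<epsilon> * A2_integral s f"
proof -
  define p where "p = norm (\<phi> 0)"
  have p: "0 \<le> p" "p < 1"
    using \<phi>(2) by (auto simp: p_def image_subset_iff)
  define K where "K = 2 * (1 + p) / (1 - p)"
  have K: "0 < K"
    using p by (simp add: K_def)
  have "0 < \<epsilon> / K * tail ((1 + p) / 2)"
    using p K \<epsilon> tail_pos[of "(1 + p) / 2"] by simp
  then have "\<forall>\<^sub>F r in at_left 1. tail r < \<epsilon> / K * tail ((1 + p) / 2)"
    using tail_tendsto_0 by (simp add: order_tendstoD)
  moreover have "\<forall>\<^sub>F r in at_left 1. \<forall>z\<in>cball 0 r. tail r < \<epsilon> / K * tail (norm (\<phi> z))"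
    using K \<epsilon> by (intro lim) auto
  ultimately have "\<forall>\<^sub>F r in at_left 1. tail r < \<epsilon> / K * tail ((1 + p) / 2)
      \<and> (\<forall>z\<in>cball 0 r. tail r < \<epsilon> / K * tail (norm (\<phi> z)))"
    by eventually_elim auto
  then obtain b where b: "b < 1" "\<And>r. b < r \<Longrightarrow> r < 1 \<Longrightarrow> tail r < \<epsilon> / K * tail ((1 + p) / 2)"
      "\<And>r z. b < r \<Longrightarrow> r < 1 \<Longrightarrow> z \<in> cball 0 r \<Longrightarrow> tail r < \<epsilon> / K * tail (norm (\<phi> z))"
    unfolding eventually_at_left_field by auto
  \<comment> \<open>Strictly beyond \<open>b\<close>, because the comparison with the midpoint is
    needed at \<open>a\<close> itself.\<close>
  define a where "a = (1 + max 0 b) / 2"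
  have a: "b < a" "a < 1" "0 \<le> a"
    using b(1) by (auto simp: a_def)
  show ?thesis
  proof (rule that)
    show "a \<in> {0..<1}" using a by simp
    fix f assume f: "f holomorphic_on ball 0 1"
    have "annulus_integral a (f \<circ> \<phi>)
        \<le> ennreal (2 * (1 + norm (\<phi> 0)) / (1 - norm (\<phi> 0)) * (\<epsilon> / K)) * A2_integral s f"
    proof (rule annulus_integral_comp_le[OF f \<phi>])
      show "0 < \<epsilon> / K" using K \<epsilon> by simp
      show "tail a \<le> \<epsilon> / K * tail ((1 + norm (\<phi> 0)) / 2)"
        using b(2)[OF a(1,2)] unfolding p_def by (rule less_imp_le)
      show "tail r < \<epsilon> / K * tail (norm (\<phi> z))" if "a < r" "r < 1" "z \<in> cball 0 r" for r z
        using that a by (intro b(3)) auto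
    qed (use a in auto)
    then have "annulus_integral a (f \<circ> \<phi>) \<le> ennreal (K * (\<epsilon> / K)) * A2_integral s f"
      by (simp only: K_def p_def)
    then show "annulus_integral a (f \<circ> \<phi>) \<le> ennreal \<epsilon> * A2_integral s f"
      using K by simp
  qed
qed

subsection \<open>Compactness\<close>

text \<open>The inequality \<open>(x + y)\<^sup>2 \<le> 2 * x\<^sup>2 + 2 * y\<^sup>2\<close> takes
  the place of Minkowski's; its constant disappears in the small factor of the annulus
  estimate.\<close>

lemma A2_integral_diff_le:
  assumes "continuous_on (ball 0 1) f" "continuous_on (ball 0 1) g"
  shows "A2_integral s (\<lambda>z. f z - g z) \<le> 2 * A2_integral s f + 2 * A2_integral s g"
proof -
  let ?i = "\<lambda>f z. ennreal ((norm (f z))\<^sup>2 * s (norm z) / pi) * indicator (ball 0 1) (z::complex)"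
  have m: "?i f \<in> borel_measurable borel" "?i g \<in> borel_measurable borel"
    using measurable_integrand[of _ "{}"] assms by simp_all
  have "A2_integral s (\<lambda>z. f z - g z) \<le> (\<integral>\<^sup>+ z. 2 * ?i f z + 2 * ?i g z \<partial>lborel)"
    unfolding A2_integral_def
  proof (rule nn_integral_mono)
    fix z
    have "(norm (f z - g z))\<^sup>2 \<le> (norm (f z) + norm (g z))\<^sup>2"
      by (intro power_mono norm_triangle_ineq4) auto
    also have "\<dots> \<le> 2 * (norm (f z))\<^sup>2 + 2 * (norm (g z))\<^sup>2"
      using sum_squares_bound[of "norm (f z)" "norm (g z)"] by (simp add: power2_sum)
    finally have "(norm (f z - g z))\<^sup>2 * (s (norm z) / pi)
        \<le> (2 * (norm (f z))\<^sup>2 + 2 * (norm (g z))\<^sup>2) * (s (norm z) / pi)"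
      using weight_nonneg by (intro mult_right_mono) auto
    then have "ennreal ((norm (f z - g z))\<^sup>2 * s (norm z) / pi)
        \<le> ennreal (2 * ((norm (f z))\<^sup>2 * s (norm z) / pi) + 2 * ((norm (g z))\<^sup>2 * s (norm z) / pi))"
      by (intro ennreal_leI) (simp add: field_simps)
    also have "\<dots> = 2 * ennreal ((norm (f z))\<^sup>2 * s (norm z) / pi) + 2 * ennreal ((norm (g z))\<^sup>2 * s (norm z) / pi)"
    proof -
      have "ennreal (2 * A + 2 * B) = 2 * ennreal A + 2 * ennreal B" if "0 \<le> A" "0 \<le> B" for A B
        using that by (simp add: ennreal_plus ennreal_mult)
      then show ?thesis
        using weight_nonneg[of "norm z"] by (metis divide_nonneg_pos mult_nonneg_nonneg pi_gt_zero zero_le_power2)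
    qed
    finally show "ennreal ((norm (f z - g z))\<^sup>2 * s (norm z) / pi) * indicator (ball 0 1) z
        \<le> 2 * ?i f z + 2 * ?i g z"
      by (simp split: split_indicator)
  qed
  also have "\<dots> = 2 * A2_integral s f + 2 * A2_integral s g"
    unfolding A2_integral_def using m by (subst nn_integral_add) (auto simp: nn_integral_cmult)
  finally show ?thesis .
qed

text \<open>Fatou's lemma. It puts the limit supplied by Montel's theorem into the space.\<close>

lemma A2_integral_le_of_pointwise_limit:
  assumes cont: "\<And>n. continuous_on (ball 0 1) (f n)"
    and lim: "\<And>z. z \<in> ball 0 1 \<Longrightarrow> (\<lambda>n. f n z) \<longlonglongrightarrow> h z"
    and le: "\<And>n. A2_integral s (f n) \<le> C"
  shows "A2_integral s h \<le> C"
proof -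
  let ?i = "\<lambda>f z. ennreal ((norm (f z))\<^sup>2 * s (norm z) / pi) * indicator (ball 0 1) (z::complex)"
  have m: "?i (f n) \<in> borel_measurable borel" for n
    using measurable_integrand[of _ "{}"] cont by simp
  have "?i h z = liminf (\<lambda>n. ?i (f n) z)" for z
  proof (rule lim_imp_Liminf[symmetric])
    show "(\<lambda>n. ?i (f n) z) \<longlonglongrightarrow> ?i h z"
    proof (cases "z \<in> ball 0 1")
      case True
      then show ?thesis
        by (auto intro!: tendsto_ennrealI tendsto_intros lim)
    qed simp
  qed simp
  then have "A2_integral s h = (\<integral>\<^sup>+ z. liminf (\<lambda>n. ?i (f n) z) \<partial>lborel)"
    unfolding A2_integral_def by simp
  also have "\<dots> \<le> liminf (\<lambda>n. A2_integral s (f n))"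
    unfolding A2_integral_def using m by (intro nn_integral_liminf) auto
  also have "\<dots> \<le> liminf (\<lambda>n. C)"
    using le by (intro Liminf_mono) auto
  also have "\<dots> = C"
    by (simp add: Liminf_const)
  finally show ?thesis .
qed

text \<open>\<open>A2_norm\<close> passes through \<open>enn2real\<close>, which sends \<infinity>
  to 0, so a bound on the norm is informative only once the integral is known to be finite.\<close>

lemma A2_integral_le_norm_bound:
  assumes "A2_integral s f < \<infinity>" "A2_norm s f \<le> B"
  shows "A2_integral s f \<le> ennreal (B\<^sup>2)"
proof -
  have "0 \<le> A2_norm s f"
    by (simp add: A2_norm_def)
  then have "(A2_norm s f)\<^sup>2 \<le> B\<^sup>2"
    using assms(2) by (intro power_mono)
  then have "enn2real (A2_integral s f) \<le> B\<^sup>2"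
    by (simp add: A2_norm_def)
  then have "ennreal (enn2real (A2_integral s f)) \<le> ennreal (B\<^sup>2)"
    by (rule ennreal_leI)
  then show ?thesis
    using assms(1) by (subst (asm) ennreal_enn2real) auto
qed

lemma A2_norm_le:
  assumes "A2_integral s f \<le> ennreal (b\<^sup>2)" "0 \<le> b"
  shows "A2_norm s f \<le> b"
proof -
  have "enn2real (A2_integral s f) \<le> enn2real (ennreal (b\<^sup>2))"
    using assms(1) by (intro enn2real_mono) auto
  then show ?thesis
    unfolding A2_norm_def using assms(2) by (simp add: real_le_lsqrt)
qed

text \<open>On \<open>cball 0 a\<close> the composition sees \<open>f\<close> only on a compact
  subset of the disc, where boundedness or Montel's uniform convergence is available; outside, the
  annulus estimate is uniform in \<open>f\<close>. The limit of the subsequence is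
  \<open>h \<circ> \<phi>\<close>, which lies in the space by the boundedness part.\<close>

lemma compact_composition_of_tail_limit:
  assumes \<phi>: "\<phi> holomorphic_on ball 0 1" "\<phi> ` ball 0 1 \<subseteq> ball 0 1"
    and lim: "\<And>\<epsilon>. 0 < \<epsilon> \<Longrightarrow> \<forall>\<^sub>F r in at_left 1. \<forall>z\<in>cball 0 r. tail r < \<epsilon> * tail (norm (\<phi> z))"
  shows "compact_composition s \<phi>"
proof -
  have compact_image: "compact (\<phi> ` cball 0 a)" "\<phi> ` cball 0 a \<subseteq> ball 0 1" if "a \<in> {0..<1}" for a
  proof -
    have sub: "cball 0 a \<subseteq> ball (0::complex) 1"
      using that by auto
    show "compact (\<phi> ` cball 0 a)"
      using \<phi>(1) sub
      by (intro compact_continuous_image) (auto intro: holomorphic_on_imp_continuous_on holomorphic_on_subset)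
    show "\<phi> ` cball 0 a \<subseteq> ball 0 1"
      using \<phi>(2) sub by blast
  qed
  have hol_comp: "f \<circ> \<phi> holomorphic_on ball 0 1" if "f holomorphic_on ball 0 1" for f
    using that \<phi> by (intro holomorphic_on_compose_gen)
  have comp_le: "A2_integral s (f \<circ> \<phi>) \<le> ennreal (c\<^sup>2 * (2 * tail 0)) + annulus_integral a (f \<circ> \<phi>)"
    if "f holomorphic_on ball 0 1" "\<And>w. w \<in> \<phi> ` cball 0 a \<Longrightarrow> norm (f w) \<le> c" for f a c
    using that by (intro A2_integral_le_annulus holomorphic_on_imp_continuous_on hol_comp) auto
  have bounded: "f \<circ> \<phi> \<in> A2_space s" if f: "f \<in> A2_space s" for f
  proof -
    have hol: "f holomorphic_on ball 0 1" and fin: "A2_integral s f < \<infinity>"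
      using f by (auto simp: A2_space_def)
    \<comment> \<open>Boundedness needs no smallness: the factor 1 will do.\<close>
    obtain a where a: "a \<in> {0..<1}"
      and an: "\<And>f. f holomorphic_on ball 0 1 \<Longrightarrow> annulus_integral a (f \<circ> \<phi>) \<le> ennreal 1 * A2_integral s f"
      using annulus_integral_comp_small[OF \<phi> lim, of 1] by auto
    have "continuous_on (\<phi> ` cball 0 a) f"
      using compact_image(2)[OF a] hol holomorphic_on_imp_continuous_on continuous_on_subset by blast
    then have "bounded (f ` \<phi> ` cball 0 a)"
      using compact_image(1)[OF a] compact_imp_bounded compact_continuous_image by blast
    then obtain c where "\<And>w. w \<in> \<phi> ` cball 0 a \<Longrightarrow> norm (f w) \<le> c"
      by (auto simp: bounded_iff)
    then have "A2_integral s (f \<circ> \<phi>) \<le> ennreal (c\<^sup>2 * (2 * tail 0)) + annulus_integral a (f \<circ> \<phi>)"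
      by (intro comp_le hol) auto
    also have "\<dots> \<le> ennreal (c\<^sup>2 * (2 * tail 0)) + ennreal 1 * A2_integral s f"
      by (intro add_left_mono an hol)
    also have "\<dots> < \<infinity>"
      using fin by (simp add: less_top)
    finally show ?thesis
      using hol_comp[OF hol] by (simp add: A2_space_def)
  qed
  have compact: "\<exists>r g. strict_mono r \<and> g \<in> A2_space s \<and> (\<lambda>n. A2_norm s (\<lambda>z. F (r n) (\<phi> z) - g z)) \<longlonglongrightarrow> 0"
    if F: "\<And>n. F n \<in> A2_space s" and B: "\<And>n. A2_norm s (F n) \<le> B" for F :: "nat \<Rightarrow> complex \<Rightarrow> complex" and B
  proof -
    have holF: "F n holomorphic_on ball 0 1" for n
      using F[of n] by (simp add: A2_space_def)
    have leB: "A2_integral s (F n) \<le> ennreal (B\<^sup>2)" for n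
      using F[of n] B[of n] by (intro A2_integral_le_norm_bound) (auto simp: A2_space_def)
    \<comment> \<open>Local uniform boundedness, the hypothesis of Montel's theorem, follows from
      the bounded point evaluations.\<close>
    have loc: "\<exists>c. \<forall>h\<in>range F. \<forall>z\<in>K. norm (h z) \<le> c" if K: "compact K" "K \<subseteq> ball 0 1" for K
    proof -
      obtain a where a: "0 \<le> a" "a < 1" "\<And>z. z \<in> K \<Longrightarrow> norm z \<le> a"
        using compact_subset_unit_ballE[OF K] by blast
      define d where "d = (1 - a) / 2 * tail ((1 + a) / 2)"
      have d: "0 < d"
        using a tail_pos[of "(1 + a) / 2"] by (simp add: d_def)
      have "norm (F n z) \<le> sqrt (B\<^sup>2 / d)" if "z \<in> K" for n z
      proof -
        have "ennreal (d * (norm (F n z))\<^sup>2) \<le> ennreal (B\<^sup>2)"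
          using norm_square_le_A2_integral[OF holF a(3)[OF that] a(1,2), of n] leB[of n]
          unfolding d_def by (rule order_trans)
        then have "d * (norm (F n z))\<^sup>2 \<le> B\<^sup>2"
          by (subst (asm) ennreal_le_iff) auto
        then have "(norm (F n z))\<^sup>2 \<le> B\<^sup>2 / d"
          using d by (simp add: field_simps)
        then show ?thesis
          by (rule real_le_rsqrt)
      qed
      then show ?thesis by blast
    qed
    obtain h r where h: "h holomorphic_on ball 0 1" and r: "strict_mono r"
      and pw: "\<And>z. z \<in> ball 0 1 \<Longrightarrow> (\<lambda>n. F (r n) z) \<longlonglongrightarrow> h z"
      and unif: "\<And>K. compact K \<Longrightarrow> K \<subseteq> ball 0 1 \<Longrightarrow> uniform_limit K (F \<circ> r) h sequentially"
    proof (rule Montel[of "ball 0 1" "range F" F])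
      show "\<exists>c. \<forall>h\<in>range F. \<forall>z\<in>K. norm (h z) \<le> c" if "compact K" "K \<subseteq> ball 0 1" for K
        using that by (rule loc)
    qed (use holF in blast)+
    have leh: "A2_integral s h \<le> ennreal (B\<^sup>2)"
      by (rule A2_integral_le_of_pointwise_limit[of "\<lambda>n. F (r n)", OF _ pw leB])
        (rule holomorphic_on_imp_continuous_on[OF holF])
    then have "h \<in> A2_space s"
      using h by (auto simp: A2_space_def intro: le_less_trans)
    then have g: "h \<circ> \<phi> \<in> A2_space s"
      by (rule bounded)
    \<comment> \<open>The differences have integral at most \<open>4 * B\<^sup>2\<close>; adding 1
      makes \<open>D\<close> positive, so that the annulus factor may be divided by it.\<close>
    define D where "D = 4 * B\<^sup>2 + 1"
    have D: "0 < D" by (simp add: D_def add_nonneg_pos)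
    have leD: "A2_integral s (\<lambda>z. F (r n) z - h z) \<le> ennreal D" for n
    proof -
      have "A2_integral s (\<lambda>z. F (r n) z - h z) \<le> 2 * A2_integral s (F (r n)) + 2 * A2_integral s h"
        using holF h by (intro A2_integral_diff_le holomorphic_on_imp_continuous_on)
      also have "\<dots> \<le> 2 * ennreal (B\<^sup>2) + 2 * ennreal (B\<^sup>2)"
        by (intro add_mono mult_left_mono leB leh) auto
      also have "2 * ennreal (B\<^sup>2) = ennreal (2 * B\<^sup>2)"
        by (simp add: ennreal_mult)
      also have "ennreal (2 * B\<^sup>2) + ennreal (2 * B\<^sup>2) = ennreal (2 * B\<^sup>2 + 2 * B\<^sup>2)"
        by (rule ennreal_plus[symmetric]) auto
      also have "\<dots> \<le> ennreal D"
        by (intro ennreal_leI) (simp add: D_def)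
      finally show ?thesis .
    qed
    have "(\<lambda>n. A2_norm s (\<lambda>z. F (r n) (\<phi> z) - (h \<circ> \<phi>) z)) \<longlonglongrightarrow> 0"
    proof (rule LIMSEQ_I)
      fix e :: real assume e: "0 < e"
      \<comment> \<open>\<open>A2_norm_le\<close> yields a weak inequality, while the limit asks for
        a strict one.\<close>
      define e' where "e' = e / 2"
      have e': "0 < e'" "e' < e" using e by (auto simp: e'_def)
      obtain a where a: "a \<in> {0..<1}"
        and an: "\<And>f. f holomorphic_on ball 0 1 \<Longrightarrow>
          annulus_integral a (f \<circ> \<phi>) \<le> ennreal (e'\<^sup>2 / 2 / D) * A2_integral s f"
        using annulus_integral_comp_small[OF \<phi> lim, of "e'\<^sup>2 / 2 / D"] e' D by auto
      \<comment> \<open>Chosen so that \<open>c\<^sup>2 * (2 * tail 0) = e'\<^sup>2 / 2\<close>: the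
        inner disc and the annulus each receive half of \<open>e'\<^sup>2\<close>.\<close>
      define c where "c = sqrt (e'\<^sup>2 / 2 / (2 * tail 0))"
      have t0: "0 < tail 0" using tail_pos[of 0] by simp
      have c: "0 < c" using t0 e' by (simp add: c_def)
      have "\<forall>\<^sub>F n in sequentially. \<forall>w\<in>\<phi> ` cball 0 a. dist ((F \<circ> r) n w) (h w) < c"
        using unif[OF compact_image[OF a]] c by (rule uniform_limitD)
      then obtain n0 where n0: "\<And>n w. n \<ge> n0 \<Longrightarrow> w \<in> \<phi> ` cball 0 a \<Longrightarrow> norm (F (r n) w - h w) < c"
        by (auto simp: eventually_sequentially dist_norm)
      have "norm (A2_norm s (\<lambda>z. F (r n) (\<phi> z) - (h \<circ> \<phi>) z) - 0) < e" if n: "n \<ge> n0" for n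
      proof -
        define f where "f = (\<lambda>z. F (r n) z - h z)"
        have f: "f holomorphic_on ball 0 1"
          unfolding f_def using holF h by (intro holomorphic_intros)
        have "A2_integral s (f \<circ> \<phi>) \<le> ennreal (c\<^sup>2 * (2 * tail 0)) + annulus_integral a (f \<circ> \<phi>)"
          using n0[OF n] by (intro comp_le f) (auto simp: f_def intro: less_imp_le)
        also have "\<dots> \<le> ennreal (c\<^sup>2 * (2 * tail 0)) + ennreal (e'\<^sup>2 / 2 / D) * A2_integral s f"
          by (intro add_left_mono an f)
        also have "\<dots> \<le> ennreal (c\<^sup>2 * (2 * tail 0)) + ennreal (e'\<^sup>2 / 2 / D) * ennreal D"
          using leD[of n] unfolding f_def by (intro add_left_mono mult_left_mono) auto
        also have "ennreal (e'\<^sup>2 / 2 / D) * ennreal D = ennreal (e'\<^sup>2 / 2)"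
          using D by (simp add: ennreal_mult''[symmetric])
        also have "c\<^sup>2 * (2 * tail 0) = e'\<^sup>2 / 2"
          using t0 by (simp add: c_def)
        also have "ennreal (e'\<^sup>2 / 2) + ennreal (e'\<^sup>2 / 2) = ennreal (e'\<^sup>2)"
          by (simp add: ennreal_plus[symmetric] del: ennreal_plus)
        finally have "A2_norm s (f \<circ> \<phi>) \<le> e'"
          by (rule A2_norm_le) (use e' in simp)
        moreover have "0 \<le> A2_norm s (f \<circ> \<phi>)"
          by (simp add: A2_norm_def)
        ultimately show ?thesis
          using e' by (simp add: f_def o_def)
      qed
      then show "\<exists>n0. \<forall>n\<ge>n0. norm (A2_norm s (\<lambda>z. F (r n) (\<phi> z) - (h \<circ> \<phi>) z) - 0) < e"
        by blast
    qed
    with r g show ?thesis by blast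
  qed
  show ?thesis
    unfolding compact_composition_def using bounded compact by blast
qed

subsection \<open>The weight \<open>\<omega>\<^sub>\<sigma>\<close>\<close>


lemma omega_integrable: "0 \<le> a \<Longrightarrow> b \<le> 1 \<Longrightarrow> (\<lambda>t. (t - r) * s t) integrable_on {a..b}"
  by (rule weight_mult_integrable) (auto intro!: continuous_intros)

lemma omega_sigma_le:
  assumes "0 \<le> r" "r \<le> 1" and h: "continuous_on {0..1} h"
    and le: "\<And>t. r \<le> t \<Longrightarrow> t \<le> 1 \<Longrightarrow> t - r \<le> h t"
  shows "omega_sigma s r \<le> integral {r..1} (\<lambda>t. h t * s t)"
  unfolding omega_sigma_def
proof (rule integral_le)
  show "(\<lambda>t. h t * s t) integrable_on {r..1}"
    using assms by (intro weight_mult_integrable) auto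
  show "(t - r) * s t \<le> h t * s t" if "t \<in> {r..1}" for t
    using that le[of t] weight_nonneg[of t] by (intro mult_right_mono) auto
qed (use assms in \<open>auto intro: omega_integrable\<close>)

text \<open>For \<open>t \<le> 1\<close> we have \<open>r * t \<le> r\<close>, that is
  \<open>t - r \<le> (1 - r) * t\<close>.\<close>

lemma omega_div_le_tail:
  assumes r: "r \<in> {0..<1}"
  shows "omega_sigma s r / (1 - r) \<le> tail r"
proof -
  have "omega_sigma s r \<le> integral {r..1} (\<lambda>t. ((1 - r) * t) * s t)"
  proof (rule omega_sigma_le)
    show "t - r \<le> (1 - r) * t" if "r \<le> t" "t \<le> 1" for t
      using mult_left_mono[of t 1 r] that r by (simp add: algebra_simps)
  qed (use r in \<open>auto intro!: continuous_intros\<close>)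
  also have "\<dots> = (1 - r) * tail r"
    by (simp add: tail_def mult.assoc)
  finally show ?thesis
    using r by (simp add: field_simps)
qed

text \<open>For fixed \<open>t \<le> 1\<close> the quotient
  \<open>(t - r) / (1 - r) = 1 - (1 - t) / (1 - r)\<close> decreases in \<open>r\<close>, and the
  interval of integration shrinks.\<close>

lemma omega_div_antimono:
  assumes r: "0 \<le> r" "r \<le> r'" "r' < 1"
  shows "omega_sigma s r' / (1 - r') \<le> omega_sigma s r / (1 - r)"
proof -
  let ?c = "(1 - r') / (1 - r)"
  have "omega_sigma s r' \<le> integral {r'..1} (\<lambda>t. (?c * (t - r)) * s t)"
  proof (rule omega_sigma_le)
    fix t assume t: "r' \<le> t" "t \<le> 1"
    have "(t - r') * (1 - r) \<le> (1 - r') * (t - r)"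
      using mult_left_mono[of t 1 "r' - r"] t r by (simp add: algebra_simps)
    then show "t - r' \<le> ?c * (t - r)"
      using r by (simp add: field_simps)
  qed (use r in \<open>auto intro!: continuous_intros\<close>)
  also have "\<dots> = ?c * integral {r'..1} (\<lambda>t. (t - r) * s t)"
    by (simp add: mult.assoc)
  also have "\<dots> \<le> ?c * omega_sigma s r"
    unfolding omega_sigma_def using r
    by (intro mult_left_mono integral_subset_le omega_integrable)
      (auto intro!: mult_nonneg_nonneg weight_nonneg)
  finally show ?thesis
    using r by (simp add: field_simps)
qed

text \<open>Condition (W2) is used between \<open>r\<close> and \<open>2r - 1\<close>, the point twice as far from the boundary.\<close>

lemma tail_le_omega_div:
  assumes W2: "mono_on {0..<1} (\<lambda>r. omega_sigma s r / (1 - r) powr (1 + \<delta>))"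
    and r: "1 / 2 \<le> r" "r < 1"
  shows "tail r \<le> 2 powr (1 + \<delta>) * (omega_sigma s r / (1 - r))"
proof -
  \<comment> \<open>For \<open>t \<ge> r\<close> we have \<open>t - q \<ge> r - q = 1 - r\<close>,
    which no longer vanishes at \<open>t = r\<close>. The assumption \<open>r \<ge> 1 / 2\<close>
    makes \<open>q\<close> nonnegative.\<close>
  define q where "q = 2 * r - 1"
  have "(1 - r) * tail r = integral {r..1} (\<lambda>t. ((1 - r) * t) * s t)"
    by (simp add: tail_def mult.assoc)
  also have "\<dots> \<le> integral {r..1} (\<lambda>t. (t - q) * s t)"
  proof (rule integral_le)
    show "(1 - r) * t * s t \<le> (t - q) * s t" if "t \<in> {r..1}" for t
    proof (rule mult_right_mono)
      have "(1 - r) * t \<le> (1 - r) * 1"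
        using that r by (intro mult_left_mono) auto
      then show "(1 - r) * t \<le> t - q"
        using that by (simp add: q_def)
    qed (rule weight_nonneg)
    show "(\<lambda>t. (1 - r) * t * s t) integrable_on {r..1}"
      using r by (intro weight_mult_integrable) (auto intro!: continuous_intros)
  qed (use r in \<open>auto intro: omega_integrable\<close>)
  also have "\<dots> \<le> omega_sigma s q"
    unfolding omega_sigma_def using r
    by (intro integral_subset_le omega_integrable) (auto simp: q_def intro!: mult_nonneg_nonneg weight_nonneg)
  finally have 1: "(1 - r) * tail r \<le> omega_sigma s q" .
  have "omega_sigma s q / (1 - q) powr (1 + \<delta>) \<le> omega_sigma s r / (1 - r) powr (1 + \<delta>)"
    using r by (intro mono_onD[OF W2]) (auto simp: q_def)
  moreover have "(1 - q) powr (1 + \<delta>) = 2 powr (1 + \<delta>) * (1 - r) powr (1 + \<delta>)"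
    using r by (simp add: q_def powr_mult[symmetric])
  moreover have "0 < (1 - r) powr (1 + \<delta>)"
    using r by simp
  ultimately have "omega_sigma s q \<le> 2 powr (1 + \<delta>) * omega_sigma s r"
    by (simp add: field_simps)
  with 1 show ?thesis
    using r by (simp add: field_simps)
qed

text \<open>Points with \<open>norm z \<le> a\<close> have images of norm at most some
  \<open>m < 1\<close>, and \<open>tail r\<close> drops below the fixed
  \<open>\<epsilon> * tail m\<close>. For the others the chain is
  \<open>tail r \<le> tail (norm z) \<le> C G(z)\<close>, then the hypothesis, then
  \<open>G \<le> tail\<close> at \<open>\<phi> z\<close>. In \<open>\<epsilon> / (2 * C)\<close> the
  \<open>C\<close> undoes the (W2) constant and the 2 secures strictness.\<close>

lemma tail_limit_of_omega_limit:
  assumes \<phi>: "\<phi> holomorphic_on ball 0 1" "\<phi> ` ball 0 1 \<subseteq> ball 0 1"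
    and W2: "mono_on {0..<1} (\<lambda>r. omega_sigma s r / (1 - r) powr (1 + \<delta>))"
    and lim: "\<And>\<epsilon>. 0 < \<epsilon> \<Longrightarrow> \<exists>b<1. \<forall>z. b < norm z \<and> norm z < 1 \<longrightarrow>
        omega_sigma s (norm z) / (1 - norm z) \<le> \<epsilon> * (omega_sigma s (norm (\<phi> z)) / (1 - norm (\<phi> z)))"
    and \<epsilon>: "0 < \<epsilon>"
  shows "\<forall>\<^sub>F r in at_left 1. \<forall>z\<in>cball 0 r. tail r < \<epsilon> * tail (norm (\<phi> z))"
proof -
  define C :: real where "C = 2 powr (1 + \<delta>)"
  have C: "0 < C" by (simp add: C_def)
  then have "0 < \<epsilon> / (2 * C)" using \<epsilon> by simp
  from lim[OF this] obtain b where b: "b < 1"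
    and bz: "\<And>z. b < norm z \<Longrightarrow> norm z < 1 \<Longrightarrow> omega_sigma s (norm z) / (1 - norm z)
        \<le> \<epsilon> / (2 * C) * (omega_sigma s (norm (\<phi> z)) / (1 - norm (\<phi> z)))"
    by blast
  define a where "a = (1 + max b (1 / 2)) / 2"
  have a: "b < a" "1 / 2 \<le> a" "a < 1" using b by (auto simp: a_def)
  have \<phi>1: "norm (\<phi> z) \<in> {0..<1}" if "norm z < 1" for z
    using \<phi>(2) that by (auto simp: image_subset_iff)
  have sub: "cball 0 a \<subseteq> ball (0::complex) 1"
    using a by auto
  have "compact (\<phi> ` cball 0 a)"
    using \<phi>(1) sub
    by (intro compact_continuous_image) (auto intro: holomorphic_on_imp_continuous_on holomorphic_on_subset)
  moreover have "\<phi> ` cball 0 a \<subseteq> ball 0 1"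
    using \<phi>(2) sub by blast
  ultimately obtain m where m: "0 \<le> m" "m < 1" "\<And>w. w \<in> \<phi> ` cball 0 a \<Longrightarrow> norm w \<le> m"
    using compact_subset_unit_ballE by metis
  have "0 < \<epsilon> * tail m"
    using m \<epsilon> tail_pos[of m] by simp
  then have "\<forall>\<^sub>F r in at_left 1. tail r < \<epsilon> * tail m"
    using tail_tendsto_0 by (simp add: order_tendstoD)
  moreover have "\<forall>\<^sub>F r in at_left 1. r \<in> {0<..<1::real}"
    by (rule eventually_at_leftI[of 0]) auto
  ultimately show ?thesis
  proof eventually_elim
    case (elim r)
    show ?case
    proof
      fix z :: complex assume z: "z \<in> cball 0 r"
      then have z1: "norm z < 1" using elim by auto
      show "tail r < \<epsilon> * tail (norm (\<phi> z))"
      proof (cases "norm z \<le> a")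
        case True
        then have "tail m \<le> tail (norm (\<phi> z))"
          using m by (intro tail_antimono) auto
        then have "\<epsilon> * tail m \<le> \<epsilon> * tail (norm (\<phi> z))"
          using \<epsilon> by simp
        then show ?thesis using elim by linarith
      next
        case False
        have "tail r \<le> tail (norm z)"
          using z elim by (intro tail_antimono) auto
        also have "\<dots> \<le> C * (omega_sigma s (norm z) / (1 - norm z))"
          unfolding C_def using W2 False a z1 by (intro tail_le_omega_div) auto
        also have "\<dots> \<le> C * (\<epsilon> / (2 * C) * (omega_sigma s (norm (\<phi> z)) / (1 - norm (\<phi> z))))"
          using C False a z1 by (intro mult_left_mono bz) auto
        also have "\<dots> = \<epsilon> / 2 * (omega_sigma s (norm (\<phi> z)) / (1 - norm (\<phi> z)))"
          using C by simp
        also have "\<dots> \<le> \<epsilon> / 2 * tail (norm (\<phi> z))"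
          using \<epsilon> \<phi>1[OF z1] by (intro mult_left_mono omega_div_le_tail) auto
        also have "\<dots> < \<epsilon> * tail (norm (\<phi> z))"
          using \<epsilon> tail_pos[OF \<phi>1[OF z1]] by simp
        finally show ?thesis .
      qed
    qed
  qed
qed

text \<open>Put \<open>x = 1 - norm (\<phi> z)\<close> and \<open>y = 1 - norm z\<close>. The
  quotient in \<open>condition_kappa\<close> is \<open>G\<close> at radius
  \<open>1 - \<eta> * x\<close> over \<open>G\<close> at radius \<open>1 - x\<close>. Near the
  boundary \<open>y < \<eta> * x\<close>, so monotonicity of \<open>G\<close> and one fixed \<eta>
  settle the case of small \<open>x\<close>. If \<open>x\<close> is not small, \<open>G\<close> at
  \<open>\<phi> z\<close> is bounded below while \<open>G\<close> at \<open>z\<close> tends to 0,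
  being at most \<open>tail\<close>.\<close>

lemma omega_limit_of_condition_kappa:
  assumes \<phi>: "\<phi> ` ball 0 1 \<subseteq> ball 0 1"
    and pos: "\<And>r. r \<in> {0..<1} \<Longrightarrow> 0 < omega_sigma s r"
    and kappa: "condition_kappa (omega_sigma s)"
    and lim: "filterlim (\<lambda>z. (1 - norm (\<phi> z)) / (1 - norm z)) at_top (filtercomap norm (at_left 1))"
    and \<epsilon>: "0 < \<epsilon>"
  shows "\<exists>b<1. \<forall>z. b < norm z \<and> norm z < 1 \<longrightarrow>
    omega_sigma s (norm z) / (1 - norm z) \<le> \<epsilon> * (omega_sigma s (norm (\<phi> z)) / (1 - norm (\<phi> z)))"
proof -
  let ?L = "\<lambda>\<eta>. Limsup (at_right 0) (\<lambda>x. ereal (omega_sigma s (1 - \<eta> * x) / (\<eta> * omega_sigma s (1 - x))))"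
  let ?G = "\<lambda>r. omega_sigma s r / (1 - r)"
  have "\<forall>\<^sub>F \<eta> in at_right 0. ?L \<eta> < ereal \<epsilon>"
    using kappa \<epsilon> unfolding condition_kappa_def by (intro order_tendstoD(2)) auto
  moreover have "\<forall>\<^sub>F \<eta> in at_right 0. \<eta> \<in> {0<..<1::real}"
    by (rule eventually_at_rightI[of _ 1]) auto
  ultimately have "\<forall>\<^sub>F \<eta> in at_right 0. \<eta> \<in> {0<..<1} \<and> ?L \<eta> < ereal \<epsilon>"
    by eventually_elim auto
  then have "\<exists>\<eta>. \<eta> \<in> {0<..<1} \<and> ?L \<eta> < ereal \<epsilon>"
    by (rule eventually_happens'[rotated]) simp
  then obtain \<eta> where \<eta>: "0 < \<eta>" "\<eta> < 1" and L: "?L \<eta> < ereal \<epsilon>"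
    by auto
  from Limsup_lessD[OF L] obtain x1 where x1: "0 < x1"
    and x1': "\<And>x. 0 < x \<Longrightarrow> x < x1 \<Longrightarrow> omega_sigma s (1 - \<eta> * x) / (\<eta> * omega_sigma s (1 - x)) < \<epsilon>"
    unfolding eventually_at_right_field by auto
  \<comment> \<open>The cap at 1 keeps \<open>1 - x0\<close> a radius in \<open>{0..<1}\<close>,
    where \<open>G\<close> is positive.\<close>
  define x0 where "x0 = min x1 1"
  have x0: "0 < x0" "x0 \<le> 1" "x0 \<le> x1" using x1 by (auto simp: x0_def)
  have G0: "0 < ?G (1 - x0)"
    using x0 pos[of "1 - x0"] by simp
  have "\<forall>\<^sub>F z in filtercomap norm (at_left 1). 1 / \<eta> < (1 - norm (\<phi> z)) / (1 - norm z)"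
    using lim by (simp add: filterlim_at_top_dense)
  then obtain Q where Q: "eventually Q (at_left 1)" "\<And>z. Q (norm z) \<Longrightarrow> 1 / \<eta> < (1 - norm (\<phi> z)) / (1 - norm z)"
    unfolding eventually_filtercomap by auto
  have "\<forall>\<^sub>F r in at_left 1. tail r < \<epsilon> * ?G (1 - x0)"
    by (rule order_tendstoD(2)[OF tail_tendsto_0 mult_pos_pos[OF \<epsilon> G0]])
  with Q(1) have "\<forall>\<^sub>F r in at_left 1. Q r \<and> tail r < \<epsilon> * ?G (1 - x0)"
    by eventually_elim auto
  then obtain b where b: "b < 1" "\<And>r. b < r \<Longrightarrow> r < 1 \<Longrightarrow> Q r \<and> tail r < \<epsilon> * ?G (1 - x0)"
    unfolding eventually_at_left_field by auto
  have "?G (norm z) \<le> \<epsilon> * ?G (norm (\<phi> z))" if z: "b < norm z" "norm z < 1" for z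
  proof -
    define x y where "x = 1 - norm (\<phi> z)" and "y = 1 - norm z"
    have y: "0 < y" "y \<le> 1" using z by (auto simp: y_def)
    have x: "0 < x" "x \<le> 1"
      using \<phi> z by (auto simp: x_def image_subset_iff)
    have "1 / \<eta> < x / y"
      using b(2)[OF z] Q(2)[of z] by (simp add: x_def y_def)
    then have yx: "y < \<eta> * x"
      using \<eta> y by (simp add: field_simps)
    have \<eta>x: "\<eta> * x < 1"
    proof -
      have "\<eta> * x \<le> \<eta> * 1"
        using \<eta> x(2) by (intro mult_left_mono) auto
      then show ?thesis using \<eta> by linarith
    qed
    show ?thesis
    proof (cases "x < x0")
      case True
      have "?G (1 - y) \<le> ?G (1 - \<eta> * x)"
        using yx y \<eta>x by (intro omega_div_antimono) auto
      also have "\<dots> \<le> \<epsilon> * ?G (1 - x)"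
      proof -
        have "0 < omega_sigma s (1 - x)"
          using x by (intro pos) auto
        moreover have "omega_sigma s (1 - \<eta> * x) / (\<eta> * omega_sigma s (1 - x)) < \<epsilon>"
          using True x0 x by (intro x1') auto
        ultimately have "omega_sigma s (1 - \<eta> * x) \<le> \<epsilon> * (\<eta> * omega_sigma s (1 - x))"
          using \<eta> by (simp add: pos_divide_less_eq less_imp_le)
        then have "omega_sigma s (1 - \<eta> * x) / (\<eta> * x) \<le> \<epsilon> * (\<eta> * omega_sigma s (1 - x)) / (\<eta> * x)"
          using \<eta> x by (intro divide_right_mono) auto
        then show ?thesis
          using \<eta> by simp
      qed
      finally show ?thesis
        by (simp add: x_def y_def)
    next
      case False
      have "?G (norm z) \<le> tail (norm z)"
        using z by (intro omega_div_le_tail) auto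
      also have "\<dots> \<le> \<epsilon> * ?G (1 - x0)"
        using b(2)[OF z] by simp
      also have "\<dots> \<le> \<epsilon> * ?G (1 - x)"
        using False x x0 \<epsilon> by (intro mult_left_mono omega_div_antimono) auto
      finally show ?thesis
        by (simp add: x_def)
    qed
  qed
  with b(1) show ?thesis by blast
qed

end

section \<open>From the given weight to its extension by zero\<close>

theorem theorem3p3:
  fixes \<phi> :: "complex \<Rightarrow> complex" and \<sigma> :: "real \<Rightarrow> real"
  assumes phi_hol: "\<phi> holomorphic_on ball 0 1"
    and phi_maps: "\<phi> ` ball 0 1 \<subseteq> ball 0 1"
    and sigma_cont: "continuous_on {0..<1} \<sigma>"
    and sigma_pos: "\<forall>r\<in>{0..<1}. \<sigma> r > 0"
    and sigma_int: "\<sigma> integrable_on {0..<1}"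
    and adm: "I_admissible (omega_sigma \<sigma>)"
  defines "G \<equiv> (\<lambda>z::complex. omega_sigma \<sigma> (cmod z) / (1 - cmod z))"
  shows "(((\<lambda>z. G z / G (\<phi> z)) \<longlongrightarrow> 0) (filtercomap cmod (at_left 1))
            \<longrightarrow> compact_composition \<sigma> \<phi>)
       \<and> (condition_kappa (omega_sigma \<sigma>) \<and>
            filterlim (\<lambda>z. (1 - cmod (\<phi> z)) / (1 - cmod z)) at_top (filtercomap cmod (at_left 1))
            \<longrightarrow> compact_composition \<sigma> \<phi>)"
proof -
  \<comment> \<open>Outside \<open>{0..<1}\<close>, in particular at 1, \<sigma> is arbitrary. The
    cut-off changes neither the Bergman integrals nor \<open>omega_sigma\<close> at nonnegative
    arguments.\<close>
  define s where "s = (\<lambda>t. if t \<in> {0..<1} then \<sigma> t else 0)"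
  interpret radial_weight s
  proof
    show "continuous_on {0..<1} s"
      by (rule continuous_on_eq[OF sigma_cont]) (simp add: s_def)
    have "s integrable_on {0..<1}"
      using sigma_int by (rule integrable_eq) (simp add: s_def)
    then show "s integrable_on {0..1}"
      by (rule integrable_spike_set) (auto intro: negligible_subset[of "{1}"])
  qed (use sigma_pos in \<open>auto simp: s_def\<close>)
  have A2: "A2_integral \<sigma> = A2_integral s"
    unfolding A2_integral_def s_def
    by (intro ext nn_integral_cong) (auto split: split_indicator)
  have comp: "compact_composition \<sigma> \<phi> \<longleftrightarrow> compact_composition s \<phi>"
    unfolding compact_composition_def A2_space_def A2_norm_def A2 ..
  have om: "omega_sigma \<sigma> r = omega_sigma s r" if "0 \<le> r" for r
    unfolding omega_sigma_def
    by (rule integral_spike[of "{1}"]) (use that in \<open>auto simp: s_def\<close>)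
  have pos: "0 < omega_sigma s r" if "r \<in> {0..<1}" for r
  proof -
    have "\<forall>r\<in>{0..<1}. 0 < omega_sigma \<sigma> r"
      using adm unfolding I_admissible_def by blast
    then have "0 < omega_sigma \<sigma> r"
      using that by blast
    then show ?thesis
      using that om[of r] by simp
  qed
  obtain \<delta> where "mono_on {0..<1} (\<lambda>r. omega_sigma \<sigma> r / (1 - r) powr (1 + \<delta>))"
    using adm unfolding I_admissible_def by blast
  then have W2: "mono_on {0..<1} (\<lambda>r. omega_sigma s r / (1 - r) powr (1 + \<delta>))"
    by (simp add: mono_on_def om)
  have main: "compact_composition \<sigma> \<phi>"
    if "\<And>\<epsilon>. 0 < \<epsilon> \<Longrightarrow> \<exists>b<1. \<forall>z. b < norm z \<and> norm z < 1 \<longrightarrow>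
        omega_sigma s (norm z) / (1 - norm z) \<le> \<epsilon> * (omega_sigma s (norm (\<phi> z)) / (1 - norm (\<phi> z)))"
    unfolding comp
    using compact_composition_of_tail_limit[OF phi_hol phi_maps]
      tail_limit_of_omega_limit[OF phi_hol phi_maps W2 that] by blast
  have G: "G z = omega_sigma s (norm z) / (1 - norm z)" for z
    by (simp add: G_def om)
  have i: "compact_composition \<sigma> \<phi>"
    if lim: "((\<lambda>z. G z / G (\<phi> z)) \<longlongrightarrow> 0) (filtercomap cmod (at_left 1))"
  proof (rule main)
    fix \<epsilon> :: real assume \<epsilon>: "0 < \<epsilon>"
    have "\<forall>\<^sub>F z in filtercomap cmod (at_left 1). G z / G (\<phi> z) < \<epsilon>"
      using lim \<epsilon> by (rule order_tendstoD)
    then obtain Q where Q: "eventually Q (at_left 1)" "\<And>z. Q (norm z) \<Longrightarrow> G z / G (\<phi> z) < \<epsilon>"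
      unfolding eventually_filtercomap by auto
    from Q(1) obtain b where b: "b < 1" "\<And>r. b < r \<Longrightarrow> r < 1 \<Longrightarrow> Q r"
      unfolding eventually_at_left_field by auto
    have "G z \<le> \<epsilon> * G (\<phi> z)" if "b < norm z" "norm z < 1" for z
    proof -
      have "norm (\<phi> z) < 1"
        using phi_maps that by (auto simp: image_subset_iff)
      then have "0 < G (\<phi> z)"
        using pos[of "norm (\<phi> z)"] by (simp add: G)
      then show ?thesis
        using Q(2)[of z] b(2) that by (simp add: pos_divide_less_eq less_imp_le)
    qed
    then show "\<exists>b<1. \<forall>z. b < norm z \<and> norm z < 1 \<longrightarrow>
        omega_sigma s (norm z) / (1 - norm z) \<le> \<epsilon> * (omega_sigma s (norm (\<phi> z)) / (1 - norm (\<phi> z)))"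
      using b(1) unfolding G by blast
  qed
  have ii: "compact_composition \<sigma> \<phi>"
    if kappa: "condition_kappa (omega_sigma \<sigma>)"
      and lim: "filterlim (\<lambda>z. (1 - cmod (\<phi> z)) / (1 - cmod z)) at_top (filtercomap cmod (at_left 1))"
  proof (rule main)
    have "condition_kappa (omega_sigma s)"
    proof -
      \<comment> \<open>For \<eta> and \<open>x\<close> in \<open>{0<..<1}\<close> both arguments of
        \<open>omega_sigma\<close> are nonnegative, so the two weights give the same quotient; both
        limits in \<open>condition_kappa\<close> see only such values.\<close>
      have eq: "Limsup (at_right 0) (\<lambda>x. ereal (omega_sigma \<sigma> (1 - \<eta> * x) / (\<eta> * omega_sigma \<sigma> (1 - x))))
          = Limsup (at_right 0) (\<lambda>x. ereal (omega_sigma s (1 - \<eta> * x) / (\<eta> * omega_sigma s (1 - x))))"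
        if \<eta>: "\<eta> \<in> {0<..<1}" for \<eta>
      proof (rule Limsup_eq)
        have "\<forall>\<^sub>F x in at_right 0. x \<in> {0<..<1::real}"
          by (rule eventually_at_rightI[of _ 1]) auto
        then show "\<forall>\<^sub>F x in at_right 0. ereal (omega_sigma \<sigma> (1 - \<eta> * x) / (\<eta> * omega_sigma \<sigma> (1 - x)))
          = ereal (omega_sigma s (1 - \<eta> * x) / (\<eta> * omega_sigma s (1 - x)))"
        proof eventually_elim
          case (elim x)
          then have "\<eta> * x \<le> 1"
            using \<eta> by (intro mult_le_one) auto
          then show ?case
            using elim by (simp add: om)
        qed
      qed
      have "\<forall>\<^sub>F \<eta> in at_right 0. \<eta> \<in> {0<..<1::real}"
        by (rule eventually_at_rightI[of _ 1]) auto
      then have "\<forall>\<^sub>F \<eta> in at_right 0.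
          Limsup (at_right 0) (\<lambda>x. ereal (omega_sigma \<sigma> (1 - \<eta> * x) / (\<eta> * omega_sigma \<sigma> (1 - x))))
          = Limsup (at_right 0) (\<lambda>x. ereal (omega_sigma s (1 - \<eta> * x) / (\<eta> * omega_sigma s (1 - x))))"
        by eventually_elim (rule eq)
      from tendsto_cong[OF this] show ?thesis
        using kappa unfolding condition_kappa_def by simp
    qed
    then show "\<exists>b<1. \<forall>z. b < norm z \<and> norm z < 1 \<longrightarrow>
        omega_sigma s (norm z) / (1 - norm z) \<le> \<epsilon> * (omega_sigma s (norm (\<phi> z)) / (1 - norm (\<phi> z)))"
      if "0 < \<epsilon>" for \<epsilon>
      using omega_limit_of_condition_kappa[OF phi_maps pos _ lim that] by blast
  qed
  show ?thesis
    using i ii by blast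
qed

end
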